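(* For $X=2^{\mathbb N}$, $$\mathsf{BCT}_0\le_{\mathrm{sW}}1\text{-}\mathsf{GEN}\le_{\mathrm{sW}}\mathsf{BCT}_2\equiv_{\mathrm{sW}}\mathsf{BCT}_0'\le_{\mathrm{sW}}\lim\nolimits_{\mathsf J},$$ and moreover $\mathsf{BCT}_0<_{\mathrm W}1\text{-}\mathsf{GEN}$ and $\mathsf{BCT}_0'<_{\mathrm W}\lim_{\mathsf J}$.
   Context: Represented spaces and Weihrauch reducibility. The symbol $\subseteq$ in front of a domain means "possibly partial". A represented space $(X,\delta_X)$ is a set $X$ with a surjective partial map $\delta_X:\subseteq\mathbb N^{\mathbb N}\to X$. A multi-valued function $f:\subseteq X\rightrightarrows Y$ assigns to each $x\in\mathrm{dom}(f)$ a nonempty set $f(x)\subseteq Y$. A realizer $F\vdash f$ is a partial function $F:\subseteq\mathbb N^{\mathbb N}\to\mathbb N^{\mathbb N}$ with $\delta_YF(p)\in f(\delta_X(p))$ for all $p\in\mathrm{dom}(f\delta_X)$. $f\le_{\mathrm W}g$: there are computable $K,H:\subseteq\mathbb N^{\mathbb N}\to\mathbb N^{\mathbb N}$ with $H\langle\mathrm{id},GK\rangle\vdash f$ for all $G\vdash g$; $f\le_{\mathrm{sW}}g$ is defined in the same way with $HGK\vdash f$. Here $\langle p,q\rangle(2k)=p(k)$, $\langle p,q\rangle(2k+1)=q(k)$. $\equiv_{\mathrm{sW}}$ is reducibility in both directions; $f<_{\mathrm W}g$ means $f\le_{\mathrm W}g$ and $g\not\le_{\mathrm W}f$. With $\langle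 p_0,p_1,\dots\rangle(\langle i,j\rangle):=p_i(j)$, $X^{\mathbb N}$ is represented by $\delta_X^{\mathbb N}\langle p_0,p_1,\dots\rangle:=(\delta_X(p_i))_i$. $2^{\mathbb N}$ and $\mathbb N^{\mathbb N}$ carry their canonical representations (points name themselves). Jump. $\lim:\subseteq\mathbb N^{\mathbb N}\to\mathbb N^{\mathbb N}$, $\langle p_0,p_1,\dots\rangle\mapsto\lim_np_n$ (product topology). The jump $f'$ of $f:\subseteq(X,\delta_X)\rightrightarrows(Y,\delta_Y)$ is the same multi-valued function with input representation replaced by $\delta_X\circ\lim$. $\mathcal A_-(2^{\mathbb N})$ is the set of closed subsets $A$ of $2^{\mathbb N}$, a name of $A$ being an enumeration of basic open balls whose union is $2^{\mathbb N}\setminus A$ (the empty ball is allowed). $\mathcal A_+(2^{\mathbb N})$ is the same set, a name of $A$ being a name of a sequence $(x_n)_n$ in $2^{\mathbb N}\sqcup\{\infty\}$ with $\overline{\{x_n:n\in\mathbb N\}}\cap2^{\mathbb N}=A$, where $\infty$ is an added isolated point. $\mathsf{BCT}_0:\subseteq\mathcal A_-(2^{\mathbb N})^{\mathbb N}\rightrightarrows2^{\mathbb N}$ and $\mathsf{BCT}_2:\subseteq\mathcal A_+(2^{\mathbb N})^{\mathbb N}\rightrightarrows2^{\mathbb N}$ both map $(A_i)_i$ to $2^{\mathbb N}\setminus\bigcup_iA_i$, with domain all $(A_i)_i$ such that every $A_i$ has empty interior. Genericity. For $q\in2^{\mathbb N}$ let $U_i^q:=\{p\in2^{\mathbb N}:\varphi_i^{\langle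 p,q\rangle}(0)\downarrow\}$ be the $i$-th set c.e. open in $q$, where $\varphi_i^r$ is the $i$-th partial function computable with oracle $r$. A point $p\in2^{\mathbb N}$ is 1-generic in $q$ if for all $i$ there is a finite prefix $w$ of $p$ with $w2^{\mathbb N}\subseteq U_i^q$ or $w2^{\mathbb N}\cap U_i^q=\emptyset$. $1\text{-}\mathsf{GEN}:2^{\mathbb N}\rightrightarrows2^{\mathbb N}$ is $1\text{-}\mathsf{GEN}(q):=\{p:p\text{ is 1-generic in }q\}$. Jump topology. $\mathsf J:\mathbb N^{\mathbb N}\to\mathbb N^{\mathbb N}$ is the Turing jump operator, $\mathsf J(p)(i)=1$ if the $i$-th oracle machine halts on input $0$ with oracle $p$, and $0$ otherwise. The jump topology is the initial topology on $\mathbb N^{\mathbb N}$ induced by $\mathsf J$. $\lim_{\mathsf J}:\subseteq\mathbb N^{\mathbb N}\to\mathbb N^{\mathbb N}$, $\langle p_0,p_1,\dots\rangle\mapsto\lim_ip_i$ is the restriction of $\lim$ to those sequences that converge with respect to the jump topology (so $p_i\to p$ with $\mathsf J(p_i)\to\mathsf J(p)$). *)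

theory Defs
  imports "HOL-Analysis.Analysis" "HOL-Library.Nat_Bijection"
begin

type_synonym baire = "nat \<Rightarrow> nat"
type_synonym cantor = "nat \<Rightarrow> bool"

section \<open>Oracle computability\<close>

text \<open>
  Unary partial recursive functions relative to an oracle; several arguments are passed through
  the Cantor pairing \<^const>\<open>prod_encode\<close>.  \<open>PPrec f g\<close> maps \<open>(a, 0)\<close> to \<open>f a\<close> and
  \<open>(a, Suc n)\<close> to \<open>g (a, (n, v))\<close>, where \<open>v\<close> is its value at \<open>(a, n)\<close>; \<open>PMu f\<close> is
  unbounded minimisation in the second component.
\<close>

datatype prog =
    PZero | PSucc | PFst | PSnd | POracle
  | PPair prog prog | PComp prog prog | PPrec prog prog | PMu prog

primrec run :: "prog \<Rightarrow> baire \<Rightarrow> nat \<Rightarrow> nat option" where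
  "run PZero r x = Some 0"
| "run PSucc r x = Some (Suc x)"
| "run PFst r x = Some (fst (prod_decode x))"
| "run PSnd r x = Some (snd (prod_decode x))"
| "run POracle r x = Some (r x)"
| "run (PPair f g) r x =
     Option.bind (run f r x) (\<lambda>a. Option.bind (run g r x) (\<lambda>b. Some (prod_encode (a, b))))"
| "run (PComp f g) r x = Option.bind (run g r x) (run f r)"
| "run (PPrec f g) r x =
     (let (a, n) = prod_decode x in
      rec_nat (run f r a)
        (\<lambda>m u. Option.bind u (\<lambda>v. run g r (prod_encode (a, prod_encode (m, v))))) n)"
| "run (PMu f) r x =
     (if \<exists>n. run f r (prod_encode (x, n)) = Some 0 \<and>
             (\<forall>m<n. \<exists>v. run f r (prod_encode (x, m)) = Some (Suc v))
      then Some (LEAST n. run f r (prod_encode (x, n)) = Some 0)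
      else None)"

text \<open>An effective numbering of programs.\<close>

function prog_of_nat :: "nat \<Rightarrow> prog" where
  "prog_of_nat n =
     (if n = 0 then PZero else if n = 1 then PSucc else if n = 2 then PFst
      else if n = 3 then PSnd else if n = 4 then POracle
      else let c = (n - 5) mod 4; k = (n - 5) div 4; a = fst (prod_decode k);
               b = snd (prod_decode k) in
           if c = 0 then PPair (prog_of_nat a) (prog_of_nat b)
           else if c = 1 then PComp (prog_of_nat a) (prog_of_nat b)
           else if c = 2 then PPrec (prog_of_nat a) (prog_of_nat b)
           else PMu (prog_of_nat k))"
  by pat_completeness auto

termination
proof -
  have fst_le: "fst (prod_decode k) \<le> k" and snd_le: "snd (prod_decode k) \<le> k" for k
    using le_prod_encode_1[of "fst (prod_decode k)" "snd (prod_decode k)"]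
      le_prod_encode_2[of "snd (prod_decode k)" "fst (prod_decode k)"] by simp_all
  have lt: "(n - 5) div 4 < n" if "n \<noteq> 0" for n :: nat
    using that by linarith
  show ?thesis
    by (relation "Wellfounded.measure id")
      (auto intro: le_less_trans[OF fst_le lt] le_less_trans[OF snd_le lt] lt)
qed

declare prog_of_nat.simps [simp del]

definition phi :: "nat \<Rightarrow> baire \<Rightarrow> nat \<Rightarrow> nat option" where
  "phi i r = run (prog_of_nat i) r"

text \<open>
  As usual for realizers, a partial function on Baire space is computable if some oracle machine
  computes it at every point of its domain; nothing is required outside the domain.
\<close>

definition computable :: "(baire \<rightharpoonup> baire) \<Rightarrow> bool" where
  "computable F \<longleftrightarrow> (\<exists>i. \<forall>p q. F p = Some q \<longrightarrow> (\<forall>n. phi i p n = Some (q n)))"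

section \<open>Represented spaces and Weihrauch reducibility\<close>

text \<open>
  A representation is a partial map from Baire space; the represented set is its range, so
  surjectivity is built in.
\<close>

type_synonym 'a rep = "baire \<rightharpoonup> 'a"

definition baire_pair :: "baire \<Rightarrow> baire \<Rightarrow> baire" where
  "baire_pair p q n = (if even n then p (n div 2) else q (n div 2))"

definition nth_seq :: "baire \<Rightarrow> nat \<Rightarrow> baire" where
  "nth_seq P i = (\<lambda>j. P (prod_encode (i, j)))"

text \<open>
  A multi-valued function between represented spaces, with its representations.  The domain is
  explicit; the values are understood to be nonempty on it.
\<close>

record ('a, 'b) problem =
  in_rep :: "'a rep"
  out_rep :: "'b rep"
  pdom :: "'a set"
  vals :: "'a \<Rightarrow> 'b set"

definition realizes :: "(baire \<rightharpoonup> baire) \<Rightarrow> ('a, 'b) problem \<Rightarrow> bool" (infix "\<turnstile>\<^sub>r" 50) where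
  "F \<turnstile>\<^sub>r f \<longleftrightarrow>
     (\<forall>p x. in_rep f p = Some x \<and> x \<in> pdom f \<longrightarrow>
        (\<exists>q y. F p = Some q \<and> out_rep f q = Some y \<and> y \<in> vals f x))"

definition weihrauch_le :: "('a, 'b) problem \<Rightarrow> ('c, 'd) problem \<Rightarrow> bool" (infix "\<le>\<^sub>W" 50) where
  "f \<le>\<^sub>W g \<longleftrightarrow>
     (\<exists>K H. computable K \<and> computable H \<and>
        (\<forall>G. G \<turnstile>\<^sub>r g \<longrightarrow>
           (\<lambda>p. Option.bind ((G \<circ>\<^sub>m K) p) (\<lambda>q. H (baire_pair p q))) \<turnstile>\<^sub>r f))"

definition strong_weihrauch_le :: "('a, 'b) problem \<Rightarrow> ('c, 'd) problem \<Rightarrow> bool"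
    (infix "\<le>\<^sub>s\<^sub>W" 50) where
  "f \<le>\<^sub>s\<^sub>W g \<longleftrightarrow>
     (\<exists>K H. computable K \<and> computable H \<and> (\<forall>G. G \<turnstile>\<^sub>r g \<longrightarrow> H \<circ>\<^sub>m G \<circ>\<^sub>m K \<turnstile>\<^sub>r f))"

definition strong_weihrauch_equiv :: "('a, 'b) problem \<Rightarrow> ('c, 'd) problem \<Rightarrow> bool"
    (infix "\<equiv>\<^sub>s\<^sub>W" 50) where
  "f \<equiv>\<^sub>s\<^sub>W g \<longleftrightarrow> f \<le>\<^sub>s\<^sub>W g \<and> g \<le>\<^sub>s\<^sub>W f"

definition weihrauch_less :: "('a, 'b) problem \<Rightarrow> ('c, 'd) problem \<Rightarrow> bool" (infix "<\<^sub>W" 50) where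
  "f <\<^sub>W g \<longleftrightarrow> f \<le>\<^sub>W g \<and> \<not> g \<le>\<^sub>W f"

definition baire_rep :: "baire rep" where
  "baire_rep p = Some p"

text \<open>The type \<^typ>\<open>cantor\<close> is identified with the 0-1-valued points of Baire space.\<close>

definition cantor_name :: "cantor \<Rightarrow> baire" where
  "cantor_name x = (\<lambda>n. of_bool (x n))"

definition cantor_rep :: "cantor rep" where
  "cantor_rep p = (if \<exists>x. p = cantor_name x then Some (THE x. p = cantor_name x) else None)"

definition seq_rep :: "'a rep \<Rightarrow> (nat \<Rightarrow> 'a) rep" where
  "seq_rep \<delta> P =
     (if \<forall>i. nth_seq P i \<in> dom \<delta> then Some (\<lambda>i. the (\<delta> (nth_seq P i))) else None)"

definition lim_map :: "baire \<rightharpoonup> baire" where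
  "lim_map P = (if \<exists>p. nth_seq P \<longlonglongrightarrow> p then Some (THE p. nth_seq P \<longlonglongrightarrow> p) else None)"

definition jump :: "('a, 'b) problem \<Rightarrow> ('a, 'b) problem" where
  "jump f = f\<lparr>in_rep := in_rep f \<circ>\<^sub>m lim_map\<rparr>"

section \<open>Closed subsets of Cantor space and the Baire category problems\<close>

text \<open>\<open>cylinder p n\<close> is \<open>w2\<^sup>\<nat>\<close> for the prefix \<open>w\<close> of \<open>p\<close> of length \<open>n\<close>.\<close>

definition cylinder :: "cantor \<Rightarrow> nat \<Rightarrow> cantor set" where
  "cylinder p n = {x. \<forall>k<n. x k = p k}"

text \<open>
  Number 0 is the empty ball; number \<open>\<langle>m, n\<rangle> + 1\<close> is the cylinder of length \<open>n\<close> around the \<open>m\<close>-th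
  point of the dense sequence of binary expansions of natural numbers.
\<close>

definition basic_ball :: "nat \<Rightarrow> cantor set" where
  "basic_ball c =
     (case c of 0 \<Rightarrow> {} | Suc k \<Rightarrow> (case prod_decode k of (m, n) \<Rightarrow> cylinder (bit m) n))"

definition closed_neg_rep :: "cantor set rep" where
  "closed_neg_rep p = Some (UNIV - (\<Union>i. basic_ball (p i)))"

text \<open>
  The space \<open>2\<^sup>\<nat> \<squnion> {\<infinity>}\<close>, with \<open>None\<close> for the isolated point \<open>\<infinity>\<close>.  Its representation is the
  usual one of a coproduct: the first entry of a name tells the summand.
\<close>

definition cantor_inf_rep :: "cantor option rep" where
  "cantor_inf_rep p =
     (if p 0 = 0 then map_option Some (cantor_rep (\<lambda>n. p (Suc n)))
      else if p 0 = 1 then Some None else None)"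

definition cantor_inf_topology :: "cantor option topology" where
  "cantor_inf_topology = topology (\<lambda>U. open (Some -` U))"

lemma openin_cantor_inf_topology: "openin cantor_inf_topology U \<longleftrightarrow> open (Some -` U)"
proof -
  have "istopology (\<lambda>U :: cantor option set. open (Some -` U))"
    unfolding istopology_def by (auto simp: vimage_Union)
  then show ?thesis
    by (simp add: cantor_inf_topology_def topology_inverse')
qed

definition closed_pos_rep :: "cantor set rep" where
  "closed_pos_rep p =
     map_option (\<lambda>s. Some -` (cantor_inf_topology closure_of range s)) (seq_rep cantor_inf_rep p)"

definition bct_problem :: "cantor set rep \<Rightarrow> (nat \<Rightarrow> cantor set, cantor) problem" where
  "bct_problem \<delta> =
     \<lparr>in_rep = seq_rep \<delta>, out_rep = cantor_rep,
      pdom = {A. \<forall>i. closed (A i) \<and> interior (A i) = {}},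
      vals = (\<lambda>A. UNIV - (\<Union>i. A i))\<rparr>"

definition BCT0 :: "(nat \<Rightarrow> cantor set, cantor) problem" where
  "BCT0 = bct_problem closed_neg_rep"

definition BCT2 :: "(nat \<Rightarrow> cantor set, cantor) problem" where
  "BCT2 = bct_problem closed_pos_rep"

section \<open>Genericity\<close>

definition ce_open :: "nat \<Rightarrow> cantor \<Rightarrow> cantor set" where
  "ce_open i q = {p. phi i (baire_pair (cantor_name p) (cantor_name q)) 0 \<noteq> None}"

definition one_generic_in :: "cantor \<Rightarrow> cantor \<Rightarrow> bool" where
  "one_generic_in q p \<longleftrightarrow>
     (\<forall>i. \<exists>n. cylinder p n \<subseteq> ce_open i q \<or> cylinder p n \<inter> ce_open i q = {})"

definition one_GEN :: "(cantor, cantor) problem" where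
  "one_GEN =
     \<lparr>in_rep = cantor_rep, out_rep = cantor_rep, pdom = UNIV,
      vals = (\<lambda>q. {p. one_generic_in q p})\<rparr>"

section \<open>The jump topology\<close>

definition turing_jump :: "baire \<Rightarrow> baire" where
  "turing_jump p = (\<lambda>i. if phi i p 0 \<noteq> None then 1 else 0)"

definition jump_topology :: "baire topology" where
  "jump_topology = pullback_topology UNIV turing_jump euclidean"

definition lim_J :: "(baire, baire) problem" where
  "lim_J =
     \<lparr>in_rep = baire_rep, out_rep = baire_rep,
      pdom = dom lim_map \<inter> {P. \<exists>p. limitin jump_topology (nth_seq P) p sequentially},
      vals = (\<lambda>P. {the (lim_map P)})\<rparr>"

section \<open>The encodings are the intended ones\<close>

text \<open>
  Surjectivity of the program numbering and of the representations of closed sets, uniqueness of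
  limits, and nonemptiness of the values of the Baire category problems on their stated domain.
\<close>

lemma lim_map_eq_Some: "lim_map P = Some p \<longleftrightarrow> nth_seq P \<longlonglongrightarrow> p"
proof -
  have uniq: "x = y" if "nth_seq P \<longlonglongrightarrow> x" "nth_seq P \<longlonglongrightarrow> y" for x y :: baire
  proof
    fix i
    from that have "(\<lambda>n. nth_seq P n i) \<longlonglongrightarrow> x i" "(\<lambda>n. nth_seq P n i) \<longlonglongrightarrow> y i"
      by (auto intro: continuous_on_tendsto_compose[OF continuous_on_product_coordinates]) 
    then show "x i = y i" by (rule LIMSEQ_unique)
  qed
  show ?thesis
  proof
    assume "lim_map P = Some p"
    then obtain x where x: "nth_seq P \<longlonglongrightarrow> x" and p: "p = (THE p. nth_seq P \<longlonglongrightarrow> p)"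
      by (auto simp: lim_map_def split: if_splits)
    have "(THE p. nth_seq P \<longlonglongrightarrow> p) = x"
      using x uniq by (intro the_equality) blast+
    with x p show "nth_seq P \<longlonglongrightarrow> p" by simp
  next
    assume p: "nth_seq P \<longlonglongrightarrow> p"
    have "(THE p. nth_seq P \<longlonglongrightarrow> p) = p"
      using p uniq by (intro the_equality) blast+
    with p show "lim_map P = Some p" by (auto simp: lim_map_def)
  qed
qed

lemma inj_cantor_name: "cantor_name x = cantor_name y \<longleftrightarrow> x = y"
  by (auto simp: cantor_name_def fun_eq_iff)

lemma cantor_rep_eq_Some: "cantor_rep p = Some x \<longleftrightarrow> p = cantor_name x"
  by (auto simp: cantor_rep_def inj_cantor_name)

lemma surj_prog_of_nat: "surj prog_of_nat"
proof -
  have "\<exists>n. prog_of_nat n = c" for c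
  proof (induction c)
    case PZero show ?case by (rule exI[of _ 0]) (simp add: prog_of_nat.simps)
  next case PSucc show ?case by (rule exI[of _ 1]) (simp add: prog_of_nat.simps)
  next case PFst show ?case by (rule exI[of _ 2]) (simp add: prog_of_nat.simps)
  next case PSnd show ?case by (rule exI[of _ 3]) (simp add: prog_of_nat.simps)
  next case POracle show ?case by (rule exI[of _ 4]) (simp add: prog_of_nat.simps)
  next case (PPair f g)
    then obtain a b where ab: "prog_of_nat a = f" "prog_of_nat b = g" by auto
    define k where "k = prod_encode (a, b)"
    then have k: "fst (prod_decode k) = a" "snd (prod_decode k) = b" by simp_all
    have "(4 * k + 0) div 4 = k" "(4 * k + 0) mod 4 = 0" by presburger+
    then show ?case
      by (intro exI[of _ "5 + (4 * k + 0)"], subst prog_of_nat.simps) (simp add: Let_def ab k)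
  next case (PComp f g)
    then obtain a b where ab: "prog_of_nat a = f" "prog_of_nat b = g" by auto
    define k where "k = prod_encode (a, b)"
    then have k: "fst (prod_decode k) = a" "snd (prod_decode k) = b" by simp_all
    have "(4 * k + 1) div 4 = k" "(4 * k + 1) mod 4 = 1" by presburger+
    then show ?case
      by (intro exI[of _ "5 + (4 * k + 1)"], subst prog_of_nat.simps) (simp add: Let_def ab k)
  next case (PPrec f g)
    then obtain a b where ab: "prog_of_nat a = f" "prog_of_nat b = g" by auto
    define k where "k = prod_encode (a, b)"
    then have k: "fst (prod_decode k) = a" "snd (prod_decode k) = b" by simp_all
    have "(4 * k + 2) div 4 = k" "(4 * k + 2) mod 4 = 2" by presburger+
    then show ?case
      by (intro exI[of _ "5 + (4 * k + 2)"], subst prog_of_nat.simps) (simp add: Let_def ab k)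
  next case (PMu f)
    then obtain a where "prog_of_nat a = f" by auto
    then show ?case by (intro exI[of _ "5 + (4 * a + 3)"], subst prog_of_nat.simps) (simp add: Let_def)
  qed
  then show ?thesis by (metis surjI)
qed

lemma open_cylinder: "open (cylinder p n)"
proof -
  have "cylinder p n = (\<Inter>k<n. (\<lambda>x. x k) -` {p k})" by (auto simp: cylinder_def)
  moreover have "open ((\<lambda>x::cantor. x k) -` {p k})" for k
    by (rule open_vimage) (auto intro: open_discrete continuous_on_product_coordinates)
  ultimately show ?thesis by (auto intro!: open_INT)
qed

lemma open_contains_cylinder:
  assumes "open U" "p \<in> U" shows "\<exists>n. cylinder p n \<subseteq> U"
proof -
  from product_topology_open_contains_basis[of "\<lambda>_. euclidean" UNIV U p] assms
  obtain X where X: "p \<in> (\<Pi>\<^sub>E i\<in>UNIV. X i)" "finite {i. X i \<noteq> (UNIV::bool set)}" "(\<Pi>\<^sub>E i\<in>UNIV. X i) \<subseteq> U"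
    by (auto simp: open_fun_def)
  from X(2) obtain n where n: "\<forall>i. X i \<noteq> UNIV \<longrightarrow> i < n"
    by (metis (mono_tags) bounded_nat_set_is_finite finite_nat_set_iff_bounded mem_Collect_eq)
  have "cylinder p n \<subseteq> U"
  proof
    fix x assume "x \<in> cylinder p n"
    then have "\<forall>i. x i \<in> X i" using X(1) n by (metis (mono_tags, lifting) UNIV_I PiE_iff cylinder_def mem_Collect_eq)
    then show "x \<in> U" using X(3) by auto
  qed
  then show ?thesis ..
qed

lemma cyl_ball: "\<exists>c. basic_ball c = cylinder x n"
proof -
    define m where "m = horner_sum of_bool (2::nat) (map x [0..<n])"
    have m: "bit m k = x k" if "k < n" for k using that by (simp add: m_def bit_horner_sum_bit_iff)
    have "basic_ball (Suc (prod_encode (m, n))) = cylinder x n"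
      by (auto simp: basic_ball_def cylinder_def m)
    then show ?thesis by blast
qed

lemma ran_closed_neg_rep: "ran closed_neg_rep = {A. closed A}"
proof (intro equalityI subsetI)
  fix A assume "A \<in> ran closed_neg_rep"
  then obtain p :: baire where A: "A = UNIV - (\<Union>i. basic_ball (p i))"
    by (auto simp: ran_def closed_neg_rep_def)
  have "open (basic_ball c)" for c by (auto simp: basic_ball_def open_cylinder split: nat.splits prod.splits)
  then show "A \<in> {A. closed A}" unfolding A by (simp add: closed_Diff open_UN)
next
  fix A :: "cantor set" assume "A \<in> {A. closed A}"
  then have o: "open (- A)" by auto
  define p where "p i = (if basic_ball i \<subseteq> - A then i else 0)" for i
  have "(\<Union>i. basic_ball (p i)) = -A"
  proof (intro equalityI subsetI)
    fix x assume "x \<in> -A"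
    then obtain n where n: "cylinder x n \<subseteq> -A" using open_contains_cylinder[OF o] by blast
    define m where "m = horner_sum of_bool (2::nat) (map x [0..<n])"
    have m: "bit m k = x k" if "k < n" for k using that by (simp add: m_def bit_horner_sum_bit_iff)
    have "basic_ball (Suc (prod_encode (m, n))) = cylinder x n"
      by (auto simp: basic_ball_def cylinder_def m)
    then have "x \<in> basic_ball (p (Suc (prod_encode (m, n))))" using n by (auto simp: p_def cylinder_def)
    then show "x \<in> (\<Union>i. basic_ball (p i))" by blast
  qed (auto simp: p_def basic_ball_def split: if_splits)
  then have "closed_neg_rep p = Some A" by (auto simp: closed_neg_rep_def)
  then show "A \<in> ran closed_neg_rep" by (auto simp: ran_def)
qed

lemma pos_closure: "Some -` (cantor_inf_topology closure_of range s) = closure {x. Some x \<in> range s}"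
proof -
  have ts: "topspace cantor_inf_topology = UNIV"
    unfolding topspace_def by (auto simp: openin_cantor_inf_topology intro!: exI[of _ UNIV])
  show ?thesis
  proof (intro set_eqI iffI)
    fix x assume x: "x \<in> Some -` (cantor_inf_topology closure_of range s)"
    show "x \<in> closure {x. Some x \<in> range s}"
      unfolding closure_iff_nhds_not_empty
    proof safe
      fix A V assume "V \<subseteq> A" "open V" "x \<in> V" "{x. Some x \<in> range s} \<inter> A = {}"
      moreover have "openin cantor_inf_topology (Some ` V)" using \<open>open V\<close> 
        by (simp add: openin_cantor_inf_topology inj_vimage_image_eq)
      moreover have "Some x \<in> Some ` V" using \<open>x \<in> V\<close> by simp
      ultimately obtain y where "y \<in> range s" "y \<in> Some ` V"
        using x[unfolded vimage_eq in_closure_of] by meson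
      then obtain z where "Some z \<in> range s" "z \<in> V" by (metis imageE)
      then show False using \<open>V \<subseteq> A\<close> \<open>{x. Some x \<in> range s} \<inter> A = {}\<close> by blast
    qed
  next
    fix x assume x: "x \<in> closure {x. Some x \<in> range s}"
    have "\<exists>y. y \<in> range s \<and> y \<in> T" if "Some x \<in> T" "open (Some -` T)" for T
    proof -
      have "{x. Some x \<in> range s} \<inter> (Some -` T) \<noteq> {}"
        using x that by (meson closure_iff_nhds_not_empty order_refl vimageI2)
      then show ?thesis by auto
    qed
    then show "x \<in> Some -` (cantor_inf_topology closure_of range s)"
      unfolding vimage_eq in_closure_of ts openin_cantor_inf_topology by blast
  qed
qed

lemma ran_closed_pos_rep: "ran closed_pos_rep = {A. closed A}"
proof (intro equalityI subsetI)
  fix A assume "A \<in> ran closed_pos_rep"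
  then show "A \<in> {A. closed A}" by (auto simp: ran_def closed_pos_rep_def pos_closure)
next
  fix A :: "cantor set" assume "A \<in> {A. closed A}"
  define T where "T = (\<lambda>c. SOME x. x \<in> basic_ball c \<inter> A) ` {c. basic_ball c \<inter> A \<noteq> {}}"
  have T: "countable T" "T \<subseteq> A" unfolding T_def
    using someI_ex[of "\<lambda>x. x \<in> basic_ball _ \<inter> A"] by (auto simp: ex_in_conv[symmetric])
  have T3: "A \<subseteq> closure T"
  proof
    fix x assume x: "x \<in> A"
    show "x \<in> closure T" unfolding closure_iff_nhds_not_empty
    proof safe
      fix B V assume "V \<subseteq> B" "open V" "x \<in> V" "T \<inter> B = {}"
      then obtain n where n: "cylinder x n \<subseteq> V" using open_contains_cylinder by blast
      from cyl_ball[of x n] obtain c where c: "basic_ball c = cylinder x n" by blast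
      have "x \<in> basic_ball c \<inter> A" using x by (simp add: c) (simp add: cylinder_def)
      then have "(SOME x. x \<in> basic_ball c \<inter> A) \<in> basic_ball c" "(SOME x. x \<in> basic_ball c \<inter> A) \<in> T"
        using someI[of "\<lambda>x. x \<in> basic_ball c \<inter> A"] unfolding T_def by blast+
      then show False using \<open>T \<inter> B = {}\<close> \<open>V \<subseteq> B\<close> n c by blast
    qed
  qed
  have A: "A = closure T" using T T3 \<open>A \<in> _\<close> by (simp add: closure_minimal subset_antisym)
  define E where "E = insert None (Some ` T)"
  have "countable E" "E \<noteq> {}" using T by (auto simp: E_def)
  then have s: "range (from_nat_into E) = E" by (simp add: range_from_nat_into)
  define s where "s = from_nat_into E"
  have tot: "\<exists>p. cantor_inf_rep p = Some z" for z
  proof (cases z)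
    case None then show ?thesis by (intro exI[of _ "\<lambda>_. 1"]) (auto simp: cantor_inf_rep_def)
  next
    case (Some x) then show ?thesis 
      by (intro exI[of _ "case_nat 0 (cantor_name x)"]) (auto simp: cantor_inf_rep_def cantor_rep_eq_Some)
  qed
  then obtain N where N: "\<And>z. cantor_inf_rep (N z) = Some z" by metis
  define P where "P = (\<lambda>k. case prod_decode k of (i,j) \<Rightarrow> N (s i) j)"
  have "nth_seq P i = N (s i)" for i by (auto simp: nth_seq_def P_def)
  then have "seq_rep cantor_inf_rep P = Some s" by (auto simp: seq_rep_def N)
  then have "closed_pos_rep P = Some A" by (simp add: closed_pos_rep_def pos_closure s s_def) (simp add: E_def A image_iff)
  then show "A \<in> ran closed_pos_rep" by (auto simp: ran_def)
qed

lemma bct_vals_nonempty: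
  assumes "A \<in> pdom (bct_problem \<delta>)"
  shows "vals (bct_problem \<delta>) A \<noteq> {}"
proof -
  let ?X = "product_topology (\<lambda>_. euclidean) UNIV :: cantor topology"
  have X: "?X = euclidean" by (simp add: euclidean_product_topology)
  have "compact_space (euclidean :: bool topology)"
    by (simp add: compact_space_def finite_imp_compact)
  then have "compact_space ?X"
    by (simp add: compact_space_product_topology)
  then have lc: "locally_compact_space ?X" by (rule compact_imp_locally_compact_space)
  have "Hausdorff_space (euclidean :: bool topology)"
    unfolding Hausdorff_space_def
  proof (intro allI impI)
    fix x y :: bool
    assume "x \<in> topspace euclidean \<and> y \<in> topspace euclidean \<and> x \<noteq> y"
    then show "\<exists>U V. openin euclidean U \<and> openin euclidean V \<and> x \<in> U \<and> y \<in> V \<and> disjnt U V"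
      by (intro exI[of _ "{x}"] exI[of _ "{y}"]) (auto simp: open_discrete)
  qed
  then have H: "Hausdorff_space ?X"
    by (simp add: Hausdorff_space_product_topology)
  have "euclidean interior_of (\<Union>(range A)) = {}"
  proof (rule Baire_category_alt)
    show "completely_metrizable_space (euclidean :: cantor topology) \<or>
      locally_compact_space (euclidean :: cantor topology) \<and>
      regular_space (euclidean :: cantor topology)"
      using lc H X by (metis locally_compact_Hausdorff_imp_regular_space)
  qed (use assms in \<open>auto simp: bct_problem_def\<close>)
  then have "\<Union>(range A) \<noteq> UNIV"
    by (metis UNIV_not_empty interior_UNIV euclidean_interior_of)
  then show ?thesis by (auto simp: bct_problem_def)
qed

end

theory Submission
  imports Defs
begin

text \<open>
  Every reduction of the chain is of one shape: a total computable functional \<open>K\<close> sends a name of an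
  instance of \<open>f\<close> to a name of an instance of \<open>g\<close> all of whose solutions solve the original
  instance, so that the outer functional \<open>H\<close> is the identity (\<open>reduces_by\<close>).

  \<^item> \<open>BCT0\<close> to \<open>1-GEN\<close>: the graph of a negative name of \<open>(A\<^sub>i)\<close> is a point \<open>q\<close> of Cantor space, and the
    complement of each \<open>A\<^sub>i\<close> is c.e. open in \<open>q\<close> and dense.  A point that is 1-generic in \<open>q\<close> lies in
    every dense set that is c.e. open in \<open>q\<close>.
  \<^item> \<open>1-GEN\<close> to \<open>BCT0'\<close>: a point is 1-generic in \<open>q\<close> as soon as it avoids the frontiers of all sets
    \<open>U\<^sub>i\<^sup>q\<close>.  These are closed and nowhere dense; the complement of a frontier is the union of \<open>U\<^sub>i\<^sup>q\<close>
    with the balls disjoint from \<open>U\<^sub>i\<^sup>q\<close>.  Disjointness of a ball can be refuted in finite time, so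
    the list of these balls is a limit of computable lists.
  \<^item> \<open>BCT2\<close> to \<open>BCT0'\<close>: the balls that contain no point of a given dense sequence form a limit
    computable list for the same reason.
  \<^item> \<open>BCT0'\<close> to \<open>BCT2\<close>: a closed set \<open>A\<close> whose negative name is only known as a limit is covered by the
    closure of a computable sequence of points.  Whenever the first \<open>l\<close> entries of the approximate
    name change (at a time \<open>t \<ge> l\<close>), one point is listed in each cylinder of length \<open>l\<close> that is
    contained in none of the first \<open>l\<close> current balls.  The last change for each \<open>l\<close> makes the points
    accumulate at all of \<open>A\<close>; and a ball of the true name receives only finitely many points, so the closure is
    nowhere dense.
  \<^item> \<open>BCT0'\<close> to \<open>lim\<^sub>J\<close>: the usual construction of a point of a countable intersection of dense open
    sets, run on the approximations to the name, converges to a point that avoids the \<open>A\<^sub>i\<close>.  With the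
    frontiers of all c.e. open sets added to the list of requirements the limit is 1-generic, and the
    1-generic points are points of continuity of the Turing jump on Cantor space.  So the
    approximations converge in the jump topology.

  The composition of the second and the fourth item gives \<open>1-GEN \<le> BCT2\<close>.

  Both strictness claims rest on computable instances.  A computable instance of \<open>BCT0\<close> has a
  computable solution by effective Baire category, but no 1-generic point is computable, because the
  complement of a computable point is a dense c.e. open set.  For \<open>lim\<^sub>J\<close>, the construction above yields
  a computable sequence whose limit in the jump topology is 1-generic, hence not computable.  If \<open>lim\<^sub>J\<close>
  were reducible to \<open>BCT0'\<close>, then a single program would compute this limit from every point of a
  comeager set, and a point computed in this way is computable: by density, each value that the
  program ever outputs on a finite piece of an oracle is correct.

  The frontier construction has to be uniform in the index \<open>i\<close>, which calls for a decidable
  version of \<open>\<phi>\<^sub>i(x) = v\<close>.  It is obtained from certificates: finite sets of claims \<open>\<phi>\<^sub>i(x) = v\<close> in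
  which each claim follows in one evaluation step from claims of the set.
\<close>

section \<open>Total recursive functionals\<close>

text \<open>
  Totality is required at every oracle.  This makes the class closed under all operations below
  without side conditions; partiality enters only through unbounded searches.
\<close>

definition recursive :: "(baire \<Rightarrow> nat \<Rightarrow> nat) \<Rightarrow> bool" where
  "recursive f \<longleftrightarrow> (\<exists>c. \<forall>r x. run c r x = Some (f r x))"

definition decidable :: "(baire \<Rightarrow> nat \<Rightarrow> bool) \<Rightarrow> bool" where
  "decidable P \<longleftrightarrow> recursive (\<lambda>r x. of_bool (P r x))"

abbreviation pfst :: "nat \<Rightarrow> nat" where "pfst x \<equiv> fst (prod_decode x)"
abbreviation psnd :: "nat \<Rightarrow> nat" where "psnd x \<equiv> snd (prod_decode x)"

text \<open>
  The closure rules are stated so that resolution with them derives recursiveness from the shape of a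
  term: the argument \<open>x\<close> is an environment, and a rule for a binder
  replaces it by the pair of the old environment and the bound variable.
\<close>

named_theorems recursive_intros "closure properties of recursive functionals and decidable predicates"

lemma recursive_comp: "recursive f \<Longrightarrow> recursive g \<Longrightarrow> recursive (\<lambda>r x. f r (g r x))"
proof -
  assume "recursive f" "recursive g"
  then obtain c d where "\<forall>r x. run c r x = Some (f r x)" "\<forall>r x. run d r x = Some (g r x)"
    unfolding recursive_def by blast
  then have "\<forall>r x. run (PComp c d) r x = Some (f r (g r x))" by simp
  then show ?thesis unfolding recursive_def by blast
qed

lemma decidable_comp: "decidable P \<Longrightarrow> recursive g \<Longrightarrow> decidable (\<lambda>r x. P r (g r x))"
  unfolding decidable_def by (rule recursive_comp)

lemma recursive_pair [recursive_intros]: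
  "recursive f \<Longrightarrow> recursive g \<Longrightarrow> recursive (\<lambda>r x. prod_encode (f r x, g r x))"
proof -
  assume "recursive f" "recursive g"
  then obtain c d where "\<forall>r x. run c r x = Some (f r x)" "\<forall>r x. run d r x = Some (g r x)"
    unfolding recursive_def by blast
  then have "\<forall>r x. run (PPair c d) r x = Some (prod_encode (f r x, g r x))" by simp
  then show ?thesis unfolding recursive_def by blast
qed

lemma recursive_fst [recursive_intros]: "recursive f \<Longrightarrow> recursive (\<lambda>r x. pfst (f r x))"
  by (rule recursive_comp[of "\<lambda>r. pfst"]) (auto simp: recursive_def intro!: exI[of _ PFst])

lemma recursive_snd [recursive_intros]: "recursive f \<Longrightarrow> recursive (\<lambda>r x. psnd (f r x))"
  by (rule recursive_comp[of "\<lambda>r. psnd"]) (auto simp: recursive_def intro!: exI[of _ PSnd])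

lemma recursive_id [recursive_intros]: "recursive (\<lambda>r x. x)"
  unfolding recursive_def by (rule exI[of _ "PPair PFst PSnd"]) simp

lemma recursive_Suc [recursive_intros]: "recursive f \<Longrightarrow> recursive (\<lambda>r x. Suc (f r x))"
  by (rule recursive_comp[of "\<lambda>r. Suc"]) (auto simp: recursive_def intro!: exI[of _ PSucc])

lemma recursive_oracle [recursive_intros]: "recursive f \<Longrightarrow> recursive (\<lambda>r x. r (f r x))"
  by (rule recursive_comp[of "\<lambda>r. r"]) (auto simp: recursive_def intro!: exI[of _ POracle])

text \<open>
  All constants qualify, whether or not they are given effectively: each has a program of its own.
\<close>

lemma recursive_const [recursive_intros]: "recursive (\<lambda>r x. k)"
proof (induction k)
  case 0 show ?case unfolding recursive_def by (rule exI[of _ PZero]) simp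
next
  case (Suc k) then show ?case by (rule recursive_Suc)
qed

lemma decidable_const [recursive_intros]: "decidable (\<lambda>r x. b)"
  unfolding decidable_def by (rule recursive_const)

text \<open>
  Needed when an argument is used under a binder, where the environment has grown.
\<close>

lemma recursive_weaken: "recursive f \<Longrightarrow> recursive (\<lambda>r e. f r (pfst e))"
  by (rule recursive_comp[OF _ recursive_fst[OF recursive_id]])

lemma recursive_rec_nat [recursive_intros]:
  assumes "recursive f"
    and "recursive (\<lambda>r e. g r (pfst e) (pfst (psnd e)) (psnd (psnd e)))"
    and "recursive n"
  shows "recursive (\<lambda>r x. rec_nat (f r x) (\<lambda>m v. g r x m v) (n r x))"
proof -
  obtain c d k where c: "\<forall>r x. run c r x = Some (f r x)"
    and d: "\<forall>r e. run d r e = Some (g r (pfst e) (pfst (psnd e)) (psnd (psnd e)))"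
    and k: "\<forall>r x. run k r x = Some (n r x)"
    using assms unfolding recursive_def by blast
  have "rec_nat (Some (f r x))
      (\<lambda>m u. Option.bind u (\<lambda>v. run d r (prod_encode (x, prod_encode (m, v))))) j
      = Some (rec_nat (f r x) (\<lambda>m v. g r x m v) j)" for r x j
    by (induction j) (simp_all add: d)
  then have "\<forall>r x. run (PComp (PPrec c d) (PPair (PPair PFst PSnd) k)) r x
      = Some (rec_nat (f r x) (\<lambda>m v. g r x m v) (n r x))"
    by (simp add: c k)
  then show ?thesis unfolding recursive_def by blast
qed

lemma recursive_if [recursive_intros]:
  assumes "decidable P" "recursive f" "recursive g"
  shows "recursive (\<lambda>r x. if P r x then f r x else g r x)"
proof -
  have "recursive (\<lambda>r x. rec_nat (g r x) (\<lambda>m v. f r x) (of_bool (P r x)))"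
    using assms by (intro recursive_intros recursive_weaken[OF assms(2)] assms(1)[unfolded decidable_def])
  moreover have "rec_nat (g r x) (\<lambda>m v. f r x) (of_bool (P r x)) = (if P r x then f r x else g r x)" for r x
    by simp
  ultimately show ?thesis by simp
qed

lemma recursive_of_bool [recursive_intros]: "decidable P \<Longrightarrow> recursive (\<lambda>r x. of_bool (P r x))"
  unfolding decidable_def .

lemma recursive_add [recursive_intros]:
  assumes "recursive f" "recursive g" shows "recursive (\<lambda>r x. f r x + g r x)"
proof -
  have "recursive (\<lambda>r x. rec_nat (f r x) (\<lambda>m v. Suc v) (g r x))" by (intro recursive_intros assms)
  moreover have "rec_nat a (\<lambda>m v. Suc v) b = a + b" for a b :: nat by (induction b) simp_all
  ultimately show ?thesis by simp
qed

lemma recursive_diff [recursive_intros]: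
  assumes "recursive f" "recursive g" shows "recursive (\<lambda>r x. f r x - g r x)"
proof -
  have pred: "rec_nat 0 (\<lambda>m v. m) b = b - 1" for b :: nat by (induction b) simp_all
  have "recursive (\<lambda>r x. rec_nat (f r x) (\<lambda>m v. rec_nat 0 (\<lambda>m v. m) v) (g r x))"
    by (intro recursive_intros assms)
  moreover have "rec_nat a (\<lambda>m v. rec_nat 0 (\<lambda>m v. m) v) b = a - b" for a b :: nat
    by (induction b) (simp_all add: pred)
  ultimately show ?thesis by simp
qed

lemma recursive_mult [recursive_intros]:
  assumes "recursive f" "recursive g" shows "recursive (\<lambda>r x. f r x * g r x)"
proof -
  have "recursive (\<lambda>r x. rec_nat 0 (\<lambda>m v. v + f r x) (g r x))"
    by (intro recursive_intros assms recursive_weaken[OF assms(1)])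
  moreover have "rec_nat 0 (\<lambda>m v. v + a) b = a * b" for a b :: nat by (induction b) simp_all
  ultimately show ?thesis by simp
qed

lemma recursive_power [recursive_intros]:
  assumes "recursive f" "recursive g" shows "recursive (\<lambda>r x. f r x ^ g r x)"
proof -
  have "recursive (\<lambda>r x. rec_nat 1 (\<lambda>m v. v * f r x) (g r x))"
    by (intro recursive_intros assms recursive_weaken[OF assms(1)])
  moreover have "rec_nat 1 (\<lambda>m v. v * a) b = a ^ b" for a b :: nat by (induction b) simp_all
  ultimately show ?thesis by simp
qed

lemma decidable_not [recursive_intros]: "decidable P \<Longrightarrow> decidable (\<lambda>r x. \<not> P r x)"
proof -
  assume "decidable P"
  then have "recursive (\<lambda>r x. if P r x then 0 else 1)" by (intro recursive_intros)
  moreover have "(if P r x then 0 else 1 :: nat) = of_bool (\<not> P r x)" for r x by simp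
  ultimately show ?thesis by (simp only: decidable_def)
qed

lemma decidable_and [recursive_intros]:
  "decidable P \<Longrightarrow> decidable Q \<Longrightarrow> decidable (\<lambda>r x. P r x \<and> Q r x)"
proof -
  assume "decidable P" "decidable Q"
  then have "recursive (\<lambda>r x. if P r x then of_bool (Q r x) else 0)" by (intro recursive_intros)
  moreover have "(if P r x then of_bool (Q r x) else 0 :: nat) = of_bool (P r x \<and> Q r x)" for r x
    by simp
  ultimately show ?thesis by (simp only: decidable_def)
qed

lemma decidable_or [recursive_intros]:
  assumes "decidable P" "decidable Q" shows "decidable (\<lambda>r x. P r x \<or> Q r x)"
proof -
  have "decidable (\<lambda>r x. \<not> (\<not> P r x \<and> \<not> Q r x))" by (intro recursive_intros assms)
  then show ?thesis by (simp only: de_Morgan_conj not_not)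
qed

lemma decidable_imp [recursive_intros]:
  assumes "decidable P" "decidable Q" shows "decidable (\<lambda>r x. P r x \<longrightarrow> Q r x)"
  unfolding imp_conv_disj by (intro recursive_intros assms)

lemma decidable_iff [recursive_intros]:
  assumes "decidable P" "decidable Q" shows "decidable (\<lambda>r x. P r x = Q r x)"
  unfolding iff_conv_conj_imp by (intro recursive_intros assms)

lemma decidable_if [recursive_intros]:
  assumes "decidable P" "decidable Q" "decidable R"
  shows "decidable (\<lambda>r x. if P r x then Q r x else R r x)"
  unfolding if_bool_eq_conj by (intro recursive_intros assms)

lemma decidable_eq_0: "recursive f \<Longrightarrow> decidable (\<lambda>r x. f r x = 0)"
proof -
  assume "recursive f"
  then have "recursive (\<lambda>r x. 1 - f r x)" by (intro recursive_intros)
  moreover have "1 - f r x = of_bool (f r x = 0)" for r x by simp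
  ultimately show ?thesis by (simp only: decidable_def)
qed

lemma decidable_le [recursive_intros]:
  assumes "recursive f" "recursive g" shows "decidable (\<lambda>r x. f r x \<le> g r x)"
proof -
  have "decidable (\<lambda>r x. f r x - g r x = 0)" by (intro recursive_intros assms decidable_eq_0)
  then show ?thesis by (simp only: diff_is_0_eq)
qed

lemma decidable_less [recursive_intros]:
  assumes "recursive f" "recursive g" shows "decidable (\<lambda>r x. f r x < g r x)"
  unfolding less_eq_Suc_le by (intro recursive_intros assms)

lemma decidable_eq [recursive_intros]:
  assumes "recursive f" "recursive g" shows "decidable (\<lambda>r x. f r x = g r x)"
  unfolding eq_iff[of "_ :: nat"] by (intro recursive_intros assms)

lemma decidable_all [recursive_intros]:
  assumes "decidable (\<lambda>r e. P r (pfst e) (psnd e))" "recursive b"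
  shows "decidable (\<lambda>r x. \<forall>k<b r x. P r x k)"
proof -
  have "decidable (\<lambda>r e. P r (pfst e) (pfst (psnd e)))"
    using decidable_comp[OF assms(1), of "\<lambda>r e. prod_encode (pfst e, pfst (psnd e))"]
    by (simp add: recursive_intros)
  then have "recursive (\<lambda>r x. rec_nat 1 (\<lambda>k v. if P r x k then v else 0) (b r x))"
    by (intro recursive_intros assms(2))
  moreover have "rec_nat 1 (\<lambda>k v. if P r x k then v else 0 :: nat) n = of_bool (\<forall>k<n. P r x k)" for r x n
    by (induction n) (auto simp: less_Suc_eq)
  ultimately show ?thesis by (simp only: decidable_def)
qed

lemma decidable_ex [recursive_intros]:
  assumes "decidable (\<lambda>r e. P r (pfst e) (psnd e))" "recursive b"
  shows "decidable (\<lambda>r x. \<exists>k<b r x. P r x k)"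
proof -
  have "decidable (\<lambda>r x. \<not> (\<forall>k<b r x. \<not> P r x k))" by (intro recursive_intros assms)
  then show ?thesis by (simp only: not_all not_imp not_not)
qed

lemma recursive_mod [recursive_intros]:
  assumes "recursive f" "recursive g" shows "recursive (\<lambda>r x. f r x mod g r x)"
proof -
  have "recursive (\<lambda>r x. rec_nat 0 (\<lambda>m v. if Suc v = g r x then 0 else Suc v) (f r x))"
    by (intro recursive_intros assms recursive_weaken[OF assms(2)])
  moreover have "rec_nat 0 (\<lambda>m v. if Suc v = b then 0 else Suc v) a = a mod b" for a b :: nat
    by (induction a) (simp_all add: mod_Suc)
  ultimately show ?thesis by simp
qed

lemma recursive_div [recursive_intros]:
  assumes "recursive f" "recursive g" shows "recursive (\<lambda>r x. f r x div g r x)"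
proof -
  have "recursive (\<lambda>r x. rec_nat 0 (\<lambda>m v. if Suc m mod g r x = 0 then Suc v else v) (f r x))"
    by (intro recursive_intros assms recursive_weaken[OF assms(2)])
  moreover have "rec_nat 0 (\<lambda>m v. if Suc m mod b = 0 then Suc v else v) a = a div b" for a b :: nat
    by (induction a) (simp_all add: div_Suc)
  ultimately show ?thesis by simp
qed

lemma decidable_even [recursive_intros]: "recursive f \<Longrightarrow> decidable (\<lambda>r x. even (f r x))"
  unfolding even_iff_mod_2_eq_zero by (intro recursive_intros)

lemma decidable_bit [recursive_intros]:
  "recursive f \<Longrightarrow> recursive g \<Longrightarrow> decidable (\<lambda>r x. bit (f r x) (g r x))"
  unfolding bit_iff_odd by (intro recursive_intros)

text \<open>
  The value \<open>0\<close> signals failure; \<open>Suc c\<close> signals that \<open>c\<close> is the least solution below the bound.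
\<close>

definition bounded_search :: "(nat \<Rightarrow> bool) \<Rightarrow> nat \<Rightarrow> nat" where
  "bounded_search P b = rec_nat 0 (\<lambda>m u. if u \<noteq> 0 then u else if P m then Suc m else 0) b"

lemma recursive_bounded_search [recursive_intros]:
  assumes "decidable (\<lambda>r e. P r (pfst e) (psnd e))" "recursive b"
  shows "recursive (\<lambda>r x. bounded_search (P r x) (b r x))"
proof -
  have "decidable (\<lambda>r e. P r (pfst e) (pfst (psnd e)))"
    using decidable_comp[OF assms(1), of "\<lambda>r e. prod_encode (pfst e, pfst (psnd e))"]
    by (simp add: recursive_intros)
  then show ?thesis unfolding bounded_search_def by (intro recursive_intros assms(2))
qed

lemma bounded_search_eq:
  "bounded_search P b = (if \<exists>c<b. P c then Suc (LEAST c. P c) else 0)"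
proof (induction b)
  case 0 show ?case by (simp add: bounded_search_def)
next
  case (Suc b)
  have *: "bounded_search P (Suc b) = (if bounded_search P b \<noteq> 0 then bounded_search P b
      else if P b then Suc b else 0)"
    by (simp add: bounded_search_def)
  show ?case
  proof (cases "\<exists>c<b. P c")
    case True then show ?thesis unfolding * Suc.IH by (auto intro: less_SucI)
  next
    case False
    then have "(LEAST c. P c) = b" if "P b"
      using that by (intro Least_equality) (auto simp: not_less)
    then show ?thesis unfolding * Suc.IH using False by (auto simp: less_Suc_eq)
  qed
qed

text \<open>
  Turing reductions compose: a program that computes the oracle replaces each oracle call.
\<close>

primrec subst_oracle :: "prog \<Rightarrow> prog \<Rightarrow> prog" where
  "subst_oracle g PZero = PZero"
| "subst_oracle g PSucc = PSucc"
| "subst_oracle g PFst = PFst"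
| "subst_oracle g PSnd = PSnd"
| "subst_oracle g POracle = g"
| "subst_oracle g (PPair c d) = PPair (subst_oracle g c) (subst_oracle g d)"
| "subst_oracle g (PComp c d) = PComp (subst_oracle g c) (subst_oracle g d)"
| "subst_oracle g (PPrec c d) = PPrec (subst_oracle g c) (subst_oracle g d)"
| "subst_oracle g (PMu c) = PMu (subst_oracle g c)"

lemma run_subst_oracle:
  assumes "\<And>n. run g r n = Some (s n)"
  shows "run (subst_oracle g c) r x = run c s x"
proof (induction c arbitrary: x)
  case (PPrec c d)
  then show ?case by (simp add: Let_def split: prod.split)
next
  case (PComp c d)
  have "run (subst_oracle g c) r = run c s" by (rule ext) (rule PComp.IH)
  then show ?case using PComp by simp
qed (simp_all add: assms)

lemma recursive_compose:
  assumes "recursive F" "recursive G"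
  shows "recursive (\<lambda>r. F (G r))"
proof -
  obtain c d where "\<forall>r x. run c r x = Some (F r x)" "\<forall>r x. run d r x = Some (G r x)"
    using assms unfolding recursive_def by blast
  then have "\<forall>r x. run (subst_oracle d c) r x = Some (F (G r) x)"
    using run_subst_oracle[of d _ _ c] by simp
  then show ?thesis unfolding recursive_def by blast
qed

section \<open>Certificates for computations\<close>

text \<open>
  For a parameter \<open>G\<close> that is itself a point of Baire space depending on the environment, recursiveness
  is expressed through its uncurried form.  This and the next rule recover the form in which \<open>G\<close>
  occurs in goals.
\<close>

lemma recursive_binary:
  assumes "recursive (\<lambda>r e. G r (pfst e) (psnd e))" "recursive a" "recursive b"
  shows "recursive (\<lambda>r x. G r (a r x) (b r x))"
  using recursive_comp[OF assms(1) recursive_pair[OF assms(2,3)]] by simp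

lemma decidable_binary:
  assumes "decidable (\<lambda>r e. G r (pfst e) (psnd e))" "recursive a" "recursive b"
  shows "decidable (\<lambda>r x. G r (a r x) (b r x))"
  using decidable_comp[OF assms(1) recursive_pair[OF assms(2,3)]] by simp

text \<open>
  One step of the evaluation of program \<open>i\<close> on \<open>x\<close>, where \<open>R\<close> supplies the results of the subprograms:
  \<open>R j y u\<close> reads "program \<open>j\<close> maps \<open>y\<close> to \<open>u\<close>".  The case distinction follows the numbering of programs.
  Each premise concerns a smaller index, or for primitive recursion the same index and a smaller second
  component of the argument.
\<close>

definition justified :: "baire \<Rightarrow> (nat \<Rightarrow> nat \<Rightarrow> nat \<Rightarrow> bool) \<Rightarrow> nat \<Rightarrow> nat \<Rightarrow> nat \<Rightarrow> bool" where
  "justified r R i x v \<longleftrightarrow>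
    (let k = (i - 5) div 4; a = pfst k; b = psnd k; c = (i - 5) mod 4 in
     if i = 0 then v = 0 else if i = 1 then v = Suc x else if i = 2 then v = pfst x
     else if i = 3 then v = psnd x else if i = 4 then v = r x
     else if c = 0 then R a x (pfst v) \<and> R b x (psnd v)
     else if c = 1 then \<exists>y. R b x y \<and> R a y v
     else if c = 2 then
       (if psnd x = 0 then R a (pfst x) v
        else \<exists>u. R i (prod_encode (pfst x, psnd x - 1)) u \<and>
                 R b (prod_encode (pfst x, prod_encode (psnd x - 1, u))) v)
     else R k (prod_encode (x, v)) 0 \<and> (\<forall>m<v. \<exists>u. R k (prod_encode (x, m)) (Suc u)))"

text \<open>
  As the evaluation step is well founded, this equation determines \<open>phi\<close>: certificates can be
  built and checked against it without reference to the recursion on programs.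
\<close>

lemma phi_iff_justified:
  "phi i r x = Some v \<longleftrightarrow> justified r (\<lambda>i x v. phi i r x = Some v) i x v"
proof -
  define k c where "k = (i - 5) div 4" and "c = (i - 5) mod 4"
  have c: "c < 4" by (simp add: c_def)
  consider "i = 0" | "i = 1" | "i = 2" | "i = 3" | "i = 4" | "5 \<le> i" "c = 0" | "5 \<le> i" "c = 1"
    | "5 \<le> i" "c = 2" | "5 \<le> i" "c = 3"
    using c by linarith
  then show ?thesis
  proof cases
    case 6
    then have "prog_of_nat i = PPair (prog_of_nat (pfst k)) (prog_of_nat (psnd k))"
      by (subst prog_of_nat.simps) (simp add: Let_def flip: k_def c_def)
    then show ?thesis using 6
      by (auto simp: justified_def Let_def phi_def bind_eq_Some_conv simp flip: k_def c_def)
  next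
    case 7
    then have "prog_of_nat i = PComp (prog_of_nat (pfst k)) (prog_of_nat (psnd k))"
      by (subst prog_of_nat.simps) (simp add: Let_def flip: k_def c_def)
    then show ?thesis using 7
      by (auto simp: justified_def Let_def phi_def bind_eq_Some_conv simp flip: k_def c_def)
  next
    case 8
    then have "prog_of_nat i = PPrec (prog_of_nat (pfst k)) (prog_of_nat (psnd k))"
      by (subst prog_of_nat.simps) (simp add: Let_def flip: k_def c_def)
    then show ?thesis using 8
      by (cases "psnd x")
        (auto simp: justified_def Let_def phi_def bind_eq_Some_conv case_prod_beta simp flip: k_def c_def)
  next
    case 9
    then have p: "prog_of_nat i = PMu (prog_of_nat k)"
      by (subst prog_of_nat.simps) (simp add: Let_def flip: k_def c_def)
    define f where "f n = run (prog_of_nat k) r (prod_encode (x, n))" for n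
    have "(if \<exists>n. f n = Some 0 \<and> (\<forall>m<n. \<exists>v. f m = Some (Suc v))
           then Some (LEAST n. f n = Some 0) else None) = Some v
      \<longleftrightarrow> f v = Some 0 \<and> (\<forall>m<v. \<exists>u. f m = Some (Suc u))" (is "?l = _ \<longleftrightarrow> ?Q v")
    proof
      assume l: "?l = Some v"
      then obtain n where n: "?Q n" by (auto split: if_splits)
      then have "(LEAST n. f n = Some 0) = n"
        by (intro Least_equality) (force simp: not_less[symmetric])+
      then show "?Q v" using n l by (auto split: if_splits)
    next
      assume v: "?Q v"
      then have "(LEAST n. f n = Some 0) = v"
        by (intro Least_equality) (force simp: not_less[symmetric])+
      then show "?l = Some v" using v by auto
    qed
    note mu = this[unfolded f_def]
    show ?thesis
      unfolding justified_def Let_def k_def[symmetric] c_def[symmetric] phi_def p run.simps mu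
      using 9 by simp
  qed (auto simp: justified_def Let_def phi_def prog_of_nat.simps)
qed

text \<open>
  Monotone in \<open>R\<close>, and sensitive to \<open>R\<close> only at arguments that precede \<open>(i, x)\<close> in the well-founded
  order described above.  Hence the fixed point is unique.
\<close>

lemma justified_mono:
  assumes "justified r R i x v"
    and R': "\<And>i' x' v'. R i' x' v' \<Longrightarrow> i' < i \<or> i' = i \<and> psnd x' < psnd x \<Longrightarrow> R' i' x' v'"
  shows "justified r R' i x v"
proof -
  define k c where "k = (i - 5) div 4" and "c = (i - 5) mod 4"
  have c: "c < 4" by (simp add: c_def)
  note J = justified_def Let_def k_def[symmetric] c_def[symmetric]
  have less: "k < i" "pfst k < i" "psnd k < i" if "5 \<le> i"
  proof -
    show "k < i" using that by (simp add: k_def)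
    then show "pfst k < i" "psnd k < i"
      using le_prod_encode_1[of "pfst k" "psnd k"] le_prod_encode_2[of "psnd k" "pfst k"] by simp_all
  qed
  have sub: "R' j x' v'" if "R j x' v'" "j < i" for j x' v'
    using R' that by blast
  consider "i < 5" | "5 \<le> i" "c = 0" | "5 \<le> i" "c = 1" | "5 \<le> i" "c = 2" "psnd x = 0"
    | "5 \<le> i" "c = 2" "psnd x \<noteq> 0" | "5 \<le> i" "c = 3"
    using c by linarith
  then show ?thesis
  proof cases
    case 1
    then show ?thesis using assms(1) by (auto simp: J split: if_splits)
  next
    case 2
    then show ?thesis using assms(1) less by (simp add: J sub)
  next
    case 3
    then show ?thesis using assms(1) less by (simp add: J) (metis sub)
  next
    case 4
    then show ?thesis using assms(1) less by (simp add: J sub)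
  next
    case 5
    then obtain u where u: "R i (prod_encode (pfst x, psnd x - 1)) u"
      "R (psnd k) (prod_encode (pfst x, prod_encode (psnd x - 1, u))) v"
      using assms(1) by (auto simp: J)
    from u(1) have "R' i (prod_encode (pfst x, psnd x - 1)) u" using 5 by (intro R') simp_all
    moreover note sub[OF u(2) less(3)[OF 5(1)]]
    ultimately show ?thesis using 5 by (auto simp: J)
  next
    case 6
    then show ?thesis using assms(1) less by (simp add: J) (metis sub)
  qed
qed

lemma index_input_induct:
  fixes i x :: nat
  assumes "\<And>i x. (\<And>i' x'. i' < i \<or> i' = i \<and> psnd x' < psnd x \<Longrightarrow> P i' x') \<Longrightarrow> P i x"
  shows "P i x"
proof (induction i arbitrary: x rule: less_induct)
  case (less i)
  note outer = less
  show ?case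
  proof (induction x rule: measure_induct_rule[of psnd])
    case (less x)
    show ?case by (rule assms) (use outer less in blast)
  qed
qed

text \<open>
  A set of claims is valid if each claim follows in one step from claims of the set.  No order on the
  set has to be recorded, since the evaluation step is well founded.
\<close>

definition valid :: "baire \<Rightarrow> (nat \<Rightarrow> nat \<Rightarrow> nat \<Rightarrow> bool) \<Rightarrow> bool" where
  "valid r R \<longleftrightarrow> (\<forall>i x v. R i x v \<longrightarrow> justified r R i x v)"

lemma valid_sound:
  assumes "valid r R" "R i x v"
  shows "phi i r x = Some v"
  using assms(2)
proof (induction i x arbitrary: v rule: index_input_induct)
  case (1 i x)
  have "justified r R i x v" using assms(1) 1(2) by (simp add: valid_def)
  then have "justified r (\<lambda>i x v. phi i r x = Some v) i x v"
    by (rule justified_mono) (use 1(1) in blast)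
  then show ?case by (simp only: phi_iff_justified[symmetric])
qed

definition triple :: "nat \<Rightarrow> nat \<Rightarrow> nat \<Rightarrow> nat" where
  "triple i x v = prod_encode (i, prod_encode (x, v))"

lemma triple_eq_iff [simp]: "triple i x v = triple i' x' v' \<longleftrightarrow> i = i' \<and> x = x' \<and> v = v'"
  by (simp add: triple_def)

lemma triple_ge: "x \<le> triple i x v" "v \<le> triple i x v"
proof -
  have "prod_encode (x, v) \<le> triple i x v" unfolding triple_def by (rule le_prod_encode_2)
  then show "x \<le> triple i x v" "v \<le> triple i x v"
    using le_prod_encode_1[of x v] le_prod_encode_2[of v x] by simp_all
qed

text \<open>
  A number is read as the finite set of claims whose codes are the positions of its binary ones.
\<close>

definition listed :: "nat \<Rightarrow> nat \<Rightarrow> nat \<Rightarrow> nat \<Rightarrow> bool" where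
  "listed s i x v \<longleftrightarrow> bit s (triple i x v)"

definition certifies :: "baire \<Rightarrow> nat \<Rightarrow> nat \<Rightarrow> nat \<Rightarrow> nat \<Rightarrow> bool" where
  "certifies r s i x v \<longleftrightarrow> valid r (listed s) \<and> listed s i x v"

lemma bit_less: assumes "bit (s :: nat) n" shows "n < s"
proof -
  have "\<not> s < 2 ^ n" using assms by (auto simp: bit_iff_odd)
  moreover have "n < 2 ^ n" by (rule less_exp)
  ultimately show ?thesis by linarith
qed

text \<open>
  Everything that a listed claim mentions is below the certificate.  This bounds the quantifiers in
  the test for validity and also bounds the part of the oracle that is inspected.
\<close>

lemma listed_less: assumes "listed s i x v" shows "x < s" "v < s"
  using bit_less[of s "triple i x v"] triple_ge[of x i v] triple_ge[of v i x] assms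
  by (auto simp: listed_def)

lemma ex_bits: "finite F \<Longrightarrow> \<exists>s::nat. \<forall>n. bit s n \<longleftrightarrow> n \<in> F"
proof -
  assume "finite F"
  moreover have "bit s n \<longleftrightarrow> n \<in> set_decode s" for s :: nat and n
    by (simp add: set_decode_def bit_iff_odd)
  ultimately show ?thesis by (intro exI[of _ "set_encode F"]) simp
qed

text \<open>
  Compactness of the evaluation step; this is what makes finite certificates sufficient.
\<close>

lemma justified_finite:
  assumes "justified r R i x v"
  shows "\<exists>F. finite F \<and> (\<forall>i x v. triple i x v \<in> F \<longrightarrow> R i x v) \<and>
    justified r (\<lambda>i x v. triple i x v \<in> F) i x v"
proof -
  define k c where "k = (i - 5) div 4" and "c = (i - 5) mod 4"
  have c: "c < 4" by (simp add: c_def)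
  note J = justified_def Let_def k_def[symmetric] c_def[symmetric]
  consider "i < 5" | "5 \<le> i" "c = 0" | "5 \<le> i" "c = 1" | "5 \<le> i" "c = 2" | "5 \<le> i" "c = 3"
    using c by linarith
  then show ?thesis
  proof cases
    case 1
    then show ?thesis using assms by (intro exI[of _ "{}"]) (auto simp: J split: if_splits)
  next
    case 2
    then show ?thesis using assms
      by (intro exI[of _ "{triple (pfst k) x (pfst v), triple (psnd k) x (psnd v)}"]) (auto simp: J)
  next
    case 3
    then obtain y where "R (psnd k) x y" "R (pfst k) y v" using assms by (auto simp: J)
    then show ?thesis using 3
      by (intro exI[of _ "{triple (psnd k) x y, triple (pfst k) y v}"]) (auto simp: J)
  next
    case 4
    show ?thesis
    proof (cases "psnd x = 0")
      case True
      then show ?thesis using 4 assms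
        by (intro exI[of _ "{triple (pfst k) (pfst x) v}"]) (auto simp: J)
    next
      case False
      then obtain u where "R i (prod_encode (pfst x, psnd x - 1)) u"
        "R (psnd k) (prod_encode (pfst x, prod_encode (psnd x - 1, u))) v"
        using assms 4 by (auto simp: J)
      then show ?thesis using 4 False
        by (intro exI[of _ "{triple i (prod_encode (pfst x, psnd x - 1)) u,
              triple (psnd k) (prod_encode (pfst x, prod_encode (psnd x - 1, u))) v}"]) (auto simp: J)
    qed
  next
    case 5
    then have "R k (prod_encode (x, v)) 0" "\<forall>m<v. \<exists>u. R k (prod_encode (x, m)) (Suc u)"
      using assms by (auto simp: J)
    then obtain u where "R k (prod_encode (x, v)) 0" "\<forall>m<v. R k (prod_encode (x, m)) (Suc (u m))"
      by metis
    then show ?thesis using 5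
      by (intro exI[of _ "insert (triple k (prod_encode (x, v)) 0)
            ((\<lambda>m. triple k (prod_encode (x, m)) (Suc (u m))) ` {..<v})"])
        (auto simp: J image_iff)
  qed
qed

text \<open>
  The union of valid sets is valid.  So certificates for the finitely many premises of a step merge
  into one, and the conclusion can be added to it.
\<close>

lemma certifies_step:
  assumes "justified r (\<lambda>i x v. \<exists>s. certifies r s i x v) i x v"
  shows "\<exists>s. certifies r s i x v"
proof -
  obtain F where F: "finite F" "\<And>i x v. triple i x v \<in> F \<Longrightarrow> \<exists>s. certifies r s i x v"
    "justified r (\<lambda>i x v. triple i x v \<in> F) i x v"
    using justified_finite[OF assms] by blast
  have tri: "\<exists>i x v. z = triple i x v" for z
    by (rule exI[of _ "pfst z"], rule exI[of _ "pfst (psnd z)"], rule exI[of _ "psnd (psnd z)"])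
      (simp add: triple_def)
  have "\<exists>s. valid r (listed s) \<and> bit s z" if "z \<in> F" for z
  proof -
    obtain i x v where "z = triple i x v" using tri by blast
    with that F(2) show ?thesis by (auto simp: certifies_def listed_def)
  qed
  then have "\<forall>z\<in>F. \<exists>s. valid r (listed s) \<and> bit s z" by blast
  then have "\<exists>s. \<forall>z\<in>F. valid r (listed (s z)) \<and> bit (s z) z" by (rule bchoice)
  then obtain s where s: "\<And>z. z \<in> F \<Longrightarrow> valid r (listed (s z))" "\<And>z. z \<in> F \<Longrightarrow> bit (s z) z"
    by blast
  define S where "S = insert (triple i x v) (\<Union>z\<in>F. {n. bit (s z) n})"
  have "finite {n. bit (m::nat) n}" for m by (rule finite_subset[of _ "{..<m}"]) (auto dest: bit_less)
  then have "finite S" using F(1) by (auto simp: S_def)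
  then obtain w :: nat where w: "\<And>n. bit w n \<longleftrightarrow> n \<in> S" using ex_bits by blast
  have "valid r (listed w)"
    unfolding valid_def
  proof (intro allI impI)
    fix j y u assume "listed w j y u"
    then consider "triple j y u = triple i x v" | z where "z \<in> F" "listed (s z) j y u"
      by (auto simp: listed_def w S_def)
    then show "justified r (listed w) j y u"
    proof cases
      case 1
      then have "justified r (\<lambda>i x v. triple i x v \<in> F) j y u" using F(3) by simp
      then show ?thesis
        by (rule justified_mono) (unfold listed_def w S_def, use s(2) in blast)
    next
      case 2
      then have "justified r (listed (s z)) j y u" using s(1) by (auto simp: valid_def)
      then show ?thesis
        by (rule justified_mono) (unfold listed_def w S_def, use 2(1) in blast)
    qed
  qed
  moreover have "listed w i x v" by (simp add: listed_def w S_def)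
  ultimately show ?thesis by (auto simp: certifies_def)
qed

text \<open>
  Kleene's normal form: a computation converges exactly if it has a certificate, and being a
  certificate is a decidable relation, uniformly in the program.
\<close>

theorem phi_iff_certifies: "phi i r x = Some v \<longleftrightarrow> (\<exists>s. certifies r s i x v)"
proof
  assume "phi i r x = Some v"
  then show "\<exists>s. certifies r s i x v"
  proof (induction i x arbitrary: v rule: index_input_induct)
    case (1 i x)
    have "justified r (\<lambda>i x v. phi i r x = Some v) i x v"
      using 1(2) by (simp only: phi_iff_justified[symmetric])
    then have "justified r (\<lambda>i x v. \<exists>s. certifies r s i x v) i x v"
      by (rule justified_mono) (use 1(1) in blast)
    then show ?case by (rule certifies_step)
  qed
next
  assume "\<exists>s. certifies r s i x v"
  then show "phi i r x = Some v" by (auto simp: certifies_def intro: valid_sound)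
qed

text \<open>
  The use principle, with the certificate itself as a bound on the use.
\<close>

lemma certifies_use:
  assumes "certifies r s i x v" "\<And>n. n < s \<Longrightarrow> r' n = r n"
  shows "certifies r' s i x v"
proof -
  have "justified r' (listed s) j y u" if "listed s j y u" for j y u
  proof -
    have "justified r (listed s) j y u" using assms(1) that by (simp add: certifies_def valid_def)
    moreover have "r' y = r y" using assms(2) listed_less[OF that] by simp
    ultimately show ?thesis by (simp only: justified_def)
  qed
  then show ?thesis using assms(1) by (simp add: certifies_def valid_def)
qed

text \<open>
  A claim that is not below \<open>s\<close> cannot be listed in \<open>s\<close>, so the search for premises may be bounded.
\<close>

lemma valid_listed_iff:
  "valid r (listed s) \<longleftrightarrow>
    (\<forall>z<s. bit s z \<longrightarrow>
      (if pfst z = 0 then psnd (psnd z) = 0 else if pfst z = 1 then psnd (psnd z) = Suc (pfst (psnd z))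
       else if pfst z = 2 then psnd (psnd z) = pfst (pfst (psnd z))
       else if pfst z = 3 then psnd (psnd z) = psnd (pfst (psnd z))
       else if pfst z = 4 then psnd (psnd z) = r (pfst (psnd z))
       else if (pfst z - 5) mod 4 = 0 then
         listed s (pfst ((pfst z - 5) div 4)) (pfst (psnd z)) (pfst (psnd (psnd z))) \<and>
         listed s (psnd ((pfst z - 5) div 4)) (pfst (psnd z)) (psnd (psnd (psnd z)))
       else if (pfst z - 5) mod 4 = 1 then
         \<exists>y<s. listed s (psnd ((pfst z - 5) div 4)) (pfst (psnd z)) y \<and>
           listed s (pfst ((pfst z - 5) div 4)) y (psnd (psnd z))
       else if (pfst z - 5) mod 4 = 2 then
         (if psnd (pfst (psnd z)) = 0
          then listed s (pfst ((pfst z - 5) div 4)) (pfst (pfst (psnd z))) (psnd (psnd z))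
          else \<exists>u<s. listed s (pfst z)
                   (prod_encode (pfst (pfst (psnd z)), psnd (pfst (psnd z)) - 1)) u \<and>
                 listed s (psnd ((pfst z - 5) div 4))
                   (prod_encode (pfst (pfst (psnd z)), prod_encode (psnd (pfst (psnd z)) - 1, u)))
                   (psnd (psnd z)))
       else listed s ((pfst z - 5) div 4) (prod_encode (pfst (psnd z), psnd (psnd z))) 0 \<and>
         (\<forall>m<psnd (psnd z). \<exists>u<s. listed s ((pfst z - 5) div 4) (prod_encode (pfst (psnd z), m)) (Suc u))))"
  (is "_ \<longleftrightarrow> (\<forall>z<s. bit s z \<longrightarrow> ?J z)")
proof -
  have ex: "(\<exists>y. listed s j x y \<and> Q y) \<longleftrightarrow> (\<exists>y<s. listed s j x y \<and> Q y)" for j x Q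
    using listed_less by blast
  have ex': "(\<exists>y. listed s j x (Suc y)) \<longleftrightarrow> (\<exists>y<s. listed s j x (Suc y))" for j x
    using listed_less(2) Suc_lessD by blast
  have J: "?J z \<longleftrightarrow> justified r (listed s) (pfst z) (pfst (psnd z)) (psnd (psnd z))" for z
    unfolding justified_def Let_def ex ex' by (rule refl)
  have tri: "triple (pfst z) (pfst (psnd z)) (psnd (psnd z)) = z" for z by (simp add: triple_def)
  show ?thesis
    unfolding J
  proof
    assume "valid r (listed s)"
    then show "\<forall>z<s. bit s z \<longrightarrow> justified r (listed s) (pfst z) (pfst (psnd z)) (psnd (psnd z))"
      by (simp add: valid_def listed_def tri)
  next
    assume *: "\<forall>z<s. bit s z \<longrightarrow> justified r (listed s) (pfst z) (pfst (psnd z)) (psnd (psnd z))"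
    show "valid r (listed s)"
      unfolding valid_def
    proof (intro allI impI)
      fix i x v assume "listed s i x v"
      then have "bit s (triple i x v)" by (simp add: listed_def)
      with * bit_less[OF this] have "justified r (listed s) (pfst (triple i x v))
        (pfst (psnd (triple i x v))) (psnd (psnd (triple i x v)))" by blast
      then show "justified r (listed s) i x v" by (simp add: triple_def)
    qed
  qed
qed

lemma recursive_triple [recursive_intros]:
  assumes "recursive i" "recursive x" "recursive v"
  shows "recursive (\<lambda>r e. triple (i r e) (x r e) (v r e))"
  unfolding triple_def by (intro recursive_intros assms)

lemma decidable_listed [recursive_intros]:
  assumes "recursive s" "recursive i" "recursive x" "recursive v"
  shows "decidable (\<lambda>r e. listed (s r e) (i r e) (x r e) (v r e))"
  unfolding listed_def by (intro recursive_intros assms)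

lemma decidable_certifies [recursive_intros]:
  assumes G: "recursive (\<lambda>r e. G r (pfst e) (psnd e))"
    and s: "recursive s" and "recursive i" "recursive x" "recursive v"
  shows "decidable (\<lambda>r e. certifies (G r e) (s r e) (i r e) (x r e) (v r e))"
proof -
  note G' = recursive_binary[of G, OF G]
  \<comment> \<open>The certificate is made a variable of its own before the binders of the test are entered.\<close>
  have "decidable (\<lambda>r e. valid (G r (pfst e)) (listed (psnd e)))"
    unfolding valid_listed_iff by (intro recursive_intros G')
  note decidable_comp[OF this recursive_pair[OF recursive_id s]]
  then have "decidable (\<lambda>r e. valid (G r e) (listed (s r e)))" by simp
  then show ?thesis unfolding certifies_def by (intro recursive_intros assms)
qed

section \<open>Cylinders and c.e. open sets\<close>

lemma mem_cylinder: "x \<in> cylinder x n" by (simp add: cylinder_def)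

lemma interior_empty_iff: "interior A = {} \<longleftrightarrow> (\<forall>x n. \<exists>y\<in>cylinder x n. y \<notin> A)"
proof
  assume "interior A = {}"
  then show "\<forall>x n. \<exists>y\<in>cylinder x n. y \<notin> A"
    using interior_maximal[OF _ open_cylinder] mem_cylinder by (metis empty_iff subset_iff)
next
  assume *: "\<forall>x n. \<exists>y\<in>cylinder x n. y \<notin> A"
  show "interior A = {}"
  proof (rule ccontr)
    assume "interior A \<noteq> {}"
    then obtain x where "x \<in> interior A" by blast
    then obtain n where "cylinder x n \<subseteq> interior A" using open_contains_cylinder[OF open_interior] by blast
    then show False using * interior_subset by blast
  qed
qed

lemma closure_iff_cylinders: "x \<in> closure A \<longleftrightarrow> (\<forall>n. cylinder x n \<inter> A \<noteq> {})"
proof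
  assume "x \<in> closure A"
  then show "\<forall>n. cylinder x n \<inter> A \<noteq> {}"
    using open_Int_closure_eq_empty[OF open_cylinder] mem_cylinder by blast
next
  assume *: "\<forall>n. cylinder x n \<inter> A \<noteq> {}"
  show "x \<in> closure A"
  proof (rule ccontr)
    assume "x \<notin> closure A"
    then obtain n where "cylinder x n \<subseteq> - closure A"
      using open_contains_cylinder[of "- closure A" x] by auto
    then show False using * closure_subset[of A] by blast
  qed
qed

text \<open>
  The sequence of binary expansions of natural numbers is dense, so it can serve as the set of finite words.
\<close>

lemma ex_nat_with_bits: "\<exists>m::nat. \<forall>k<n. bit m k = x k"
  by (rule exI[of _ "horner_sum of_bool 2 (map x [0..<n])"]) (simp add: bit_horner_sum_bit_iff)

text \<open>
  Membership in \<open>basic_ball c\<close> as an arithmetical condition, which the rules for decidability apply to.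
\<close>

definition in_ball :: "cantor \<Rightarrow> nat \<Rightarrow> bool" where
  "in_ball x c \<longleftrightarrow> c \<noteq> 0 \<and> (\<forall>j<psnd (c - 1). x j = bit (pfst (c - 1)) j)"

lemma mem_basic_ball: "x \<in> basic_ball c \<longleftrightarrow> in_ball x c"
  by (cases c) (auto simp: basic_ball_def in_ball_def cylinder_def case_prod_beta)

lemma in_ball_cylinder: "in_ball x c \<Longrightarrow> cylinder x (psnd (c - 1)) = basic_ball c"
  by (auto simp: mem_basic_ball) (auto simp: in_ball_def cylinder_def)

lemma decidable_in_ball [recursive_intros]:
  assumes "decidable (\<lambda>r e. X r (pfst e) (psnd e))" and c: "recursive c"
  shows "decidable (\<lambda>r e. in_ball (X r e) (c r e))"
  unfolding in_ball_def by (intro recursive_intros assms recursive_weaken[OF c])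

lemma recursive_cantor_name [recursive_intros]:
  assumes "decidable (\<lambda>r e. X r (pfst e) (psnd e))" "recursive n"
  shows "recursive (\<lambda>r e. cantor_name (X r e) (n r e))"
  unfolding cantor_name_def by (intro recursive_intros decidable_binary[of X, OF assms(1)] assms(2))

lemma recursive_baire_pair [recursive_intros]:
  assumes X: "recursive (\<lambda>r e. X r (pfst e) (psnd e))" and Y: "recursive (\<lambda>r e. Y r (pfst e) (psnd e))"
    and "recursive n"
  shows "recursive (\<lambda>r e. baire_pair (X r e) (Y r e) (n r e))"
  unfolding baire_pair_def by (intro recursive_intros recursive_binary[of X, OF X] recursive_binary[of Y, OF Y] assms)

text \<open>
  The number \<open>s\<close> certifies that program \<open>i\<close> halts on \<open>0\<close> at the point \<open>bit m\<close> relative to \<open>q\<close>.  The bound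
  on the output \<open>v\<close> is no restriction, by \<open>listed_less\<close>.
\<close>

definition halts_at :: "baire \<Rightarrow> nat \<Rightarrow> nat \<Rightarrow> nat \<Rightarrow> bool" where
  "halts_at q i m s \<longleftrightarrow> (\<exists>v<s. certifies (baire_pair (cantor_name (bit m)) q) s i 0 v)"

lemma decidable_halts_at [recursive_intros]:
  assumes Q: "recursive (\<lambda>r e. Q r (pfst e) (psnd e))" and i: "recursive i" and m: "recursive m" and s: "recursive s"
  shows "decidable (\<lambda>r e. halts_at (Q r e) (i r e) (m r e) (s r e))"
  unfolding halts_at_def
  by (intro recursive_intros recursive_binary[of Q, OF Q] s recursive_comp[OF s] recursive_comp[OF i] recursive_comp[OF m])

text \<open>
  A certificate \<open>s\<close> inspects at most the first \<open>s\<close> bits of either half of the oracle.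
\<close>

lemma certifies_pair_cylinder:
  assumes "certifies (baire_pair (cantor_name x) q) s i n v" "y \<in> cylinder x s"
  shows "certifies (baire_pair (cantor_name y) q) s i n v"
  using assms(1)
proof (rule certifies_use)
  fix k assume "k < s"
  then have "y (k div 2) = x (k div 2)" using assms(2) div_le_dividend[of k 2]
    by (auto simp: cylinder_def)
  then show "baire_pair (cantor_name y) q k = baire_pair (cantor_name x) q k"
    by (simp add: baire_pair_def cantor_name_def)
qed

lemma certifies_pair_snd_cylinder:
  assumes "certifies (baire_pair q (cantor_name x)) s i n v" "y \<in> cylinder x s"
  shows "certifies (baire_pair q (cantor_name y)) s i n v"
  using assms(1)
proof (rule certifies_use)
  fix k assume "k < s"
  then have "y (k div 2) = x (k div 2)" using assms(2) div_le_dividend[of k 2]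
    by (auto simp: cylinder_def)
  then show "baire_pair q (cantor_name y) k = baire_pair q (cantor_name x) k"
    by (simp add: baire_pair_def cantor_name_def)
qed

lemma ce_open_iff:
  "p \<in> ce_open i q \<longleftrightarrow> (\<exists>s v. certifies (baire_pair (cantor_name p) (cantor_name q)) s i 0 v)"
  using phi_iff_certifies[of i "baire_pair (cantor_name p) (cantor_name q)" 0]
  by (auto simp: ce_open_def)

lemma halts_at_subset:
  assumes "halts_at (cantor_name q) i m s" shows "cylinder (bit m) s \<subseteq> ce_open i q"
  using assms certifies_pair_cylinder unfolding halts_at_def ce_open_iff subset_iff by blast

text \<open>
  With the converse \<open>halts_at_subset\<close>: the set \<open>U\<^sub>i\<^sup>q\<close> is the union of the cylinders given by the
  decidable relation \<open>halts_at\<close>.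
\<close>

lemma ce_open_halts_at:
  assumes "p \<in> ce_open i q"
  shows "\<exists>s. \<forall>m. (\<forall>k<s. bit m k = p k) \<longrightarrow> halts_at (cantor_name q) i m s"
proof -
  obtain s v where sv: "certifies (baire_pair (cantor_name p) (cantor_name q)) s i 0 v"
    using assms ce_open_iff by blast
  then have "v < s" by (auto simp: certifies_def dest: listed_less(2))
  moreover have "certifies (baire_pair (cantor_name (bit m)) (cantor_name q)) s i 0 v"
    if "\<forall>k<s. bit m k = p k" for m
    by (rule certifies_pair_cylinder[OF sv]) (simp add: cylinder_def that)
  ultimately show ?thesis unfolding halts_at_def by blast
qed

text \<open>
  The c.e. open sets used below are given by unbounded searches; each of them has an index.
\<close>

lemma semidecidable_phi:
  assumes "decidable P"
  shows "\<exists>i. \<forall>r. phi i r 0 \<noteq> None \<longleftrightarrow> (\<exists>n. P r n)"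
proof -
  have "recursive (\<lambda>r e. if P r (psnd e) then 0 else 1)"
    by (intro recursive_intros decidable_comp[OF assms])
  then obtain c where c: "\<And>r e. run c r e = Some (if P r (psnd e) then 0 else 1)"
    unfolding recursive_def by blast
  obtain i where i: "prog_of_nat i = PMu c" using surj_prog_of_nat by (metis surjD)
  have "phi i r 0 \<noteq> None \<longleftrightarrow> (\<exists>n. P r n \<and> (\<forall>m<n. \<not> P r m))" for r
    by (auto simp: phi_def i c)
  also have "\<dots> r \<longleftrightarrow> (\<exists>n. P r n)" for r using exists_least_iff[of "P r"] by simp
  finally show ?thesis by blast
qed

section \<open>Reductions with trivial outer functional\<close>

text \<open>
  Solutions of the instance named by \<open>K p\<close> have to be solutions of the instance named by \<open>p\<close>, under
  the same name.  This implies both reducibilities and composes.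
\<close>

definition reduces_by :: "(baire \<Rightarrow> baire) \<Rightarrow> ('a, 'b) problem \<Rightarrow> ('c, 'd) problem \<Rightarrow> bool" where
  "reduces_by K f g \<longleftrightarrow>
    (\<forall>p x. in_rep f p = Some x \<and> x \<in> pdom f \<longrightarrow>
      (\<exists>x'. in_rep g (K p) = Some x' \<and> x' \<in> pdom g \<and>
        (\<forall>q y. out_rep g q = Some y \<and> y \<in> vals g x' \<longrightarrow>
          (\<exists>z. out_rep f q = Some z \<and> z \<in> vals f x))))"

lemma computable_total:
  assumes "recursive K" shows "computable (\<lambda>p. Some (K p))"
proof -
  obtain c where "\<forall>r x. run c r x = Some (K r x)" using assms unfolding recursive_def by blast
  moreover obtain i where "prog_of_nat i = c" using surj_prog_of_nat by (metis surjD)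
  ultimately show ?thesis by (auto simp: computable_def phi_def)
qed

lemma reduces_by_strong_weihrauch_le:
  assumes "recursive K" "reduces_by K f g" shows "f \<le>\<^sub>s\<^sub>W g"
proof -
  have "computable (\<lambda>p. Some (K p))" by (rule computable_total[OF assms(1)])
  moreover have "computable Some" using computable_total[of "\<lambda>p. p"] by (simp add: recursive_intros)
  moreover have "Some \<circ>\<^sub>m G \<circ>\<^sub>m (\<lambda>p. Some (K p)) \<turnstile>\<^sub>r f" if G: "G \<turnstile>\<^sub>r g" for G
    unfolding realizes_def
  proof (intro allI impI)
    fix p x assume "in_rep f p = Some x \<and> x \<in> pdom f"
    then obtain x' where x': "in_rep g (K p) = Some x'" "x' \<in> pdom g"
      "\<And>q y. out_rep g q = Some y \<and> y \<in> vals g x' \<Longrightarrow> \<exists>z. out_rep f q = Some z \<and> z \<in> vals f x"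
      using assms(2) unfolding reduces_by_def by meson
    then obtain q y where "G (K p) = Some q" "out_rep g q = Some y" "y \<in> vals g x'"
      using G unfolding realizes_def by blast
    then show "\<exists>q y. (Some \<circ>\<^sub>m G \<circ>\<^sub>m (\<lambda>p. Some (K p))) p = Some q \<and> out_rep f q = Some y \<and> y \<in> vals f x"
      using x'(3) by (auto simp: map_comp_def)
  qed
  ultimately show ?thesis unfolding strong_weihrauch_le_def by blast
qed

lemma reduces_by_weihrauch_le:
  assumes "recursive K" "reduces_by K f g" shows "f \<le>\<^sub>W g"
proof -
  let ?H = "\<lambda>s n. s (2 * n + 1)"
  have "computable (\<lambda>p. Some (K p))" by (rule computable_total[OF assms(1)])
  moreover have "computable (\<lambda>s. Some (?H s))" by (rule computable_total) (intro recursive_intros)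
  moreover have "?H (baire_pair p q) = q" for p q by (simp add: baire_pair_def fun_eq_iff)
  then have "(\<lambda>p. Option.bind ((G \<circ>\<^sub>m (\<lambda>p. Some (K p))) p) (\<lambda>q. Some (?H (baire_pair p q)))) \<turnstile>\<^sub>r f"
    if G: "G \<turnstile>\<^sub>r g" for G
    unfolding realizes_def
  proof (intro allI impI)
    fix p x assume "in_rep f p = Some x \<and> x \<in> pdom f"
    then obtain x' where x': "in_rep g (K p) = Some x'" "x' \<in> pdom g"
      "\<And>q y. out_rep g q = Some y \<and> y \<in> vals g x' \<Longrightarrow> \<exists>z. out_rep f q = Some z \<and> z \<in> vals f x"
      using assms(2) unfolding reduces_by_def by meson
    then obtain q y where "G (K p) = Some q" "out_rep g q = Some y" "y \<in> vals g x'"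
      using G unfolding realizes_def by blast
    then show "\<exists>q y. Option.bind ((G \<circ>\<^sub>m (\<lambda>p. Some (K p))) p) (\<lambda>q. Some (?H (baire_pair p q))) = Some q
        \<and> out_rep f q = Some y \<and> y \<in> vals f x"
      using x'(3) by (auto simp: map_comp_def baire_pair_def)
  qed
  ultimately show ?thesis
    unfolding weihrauch_le_def by (intro exI[of _ "\<lambda>p. Some (K p)"] exI[of _ "\<lambda>s. Some (?H s)"]) auto
qed

lemma reduces_by_trans:
  assumes "reduces_by K f g" "reduces_by L g h" shows "reduces_by (\<lambda>p. L (K p)) f h"
  using assms unfolding reduces_by_def by meson

section \<open>Names of instances\<close>

lemma tendsto_baire: "X \<longlonglongrightarrow> (p::baire) \<longleftrightarrow> (\<forall>n. eventually (\<lambda>t. X t n = p n) sequentially)"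
proof
  assume "X \<longlonglongrightarrow> p"
  then have "(\<lambda>t. X t n) \<longlonglongrightarrow> p n" for n
    by (auto intro: continuous_on_tendsto_compose[OF continuous_on_product_coordinates])
  then show "\<forall>n. eventually (\<lambda>t. X t n = p n) sequentially" by (simp add: tendsto_discrete)
next
  assume *: "\<forall>n. eventually (\<lambda>t. X t n = p n) sequentially"
  have "limitin (product_topology (\<lambda>_. euclidean) UNIV) X p sequentially"
    unfolding limitin_componentwise using * by (auto simp: tendsto_discrete)
  then show "X \<longlonglongrightarrow> p" by (simp add: euclidean_product_topology)
qed

definition neg_closed :: "baire \<Rightarrow> nat \<Rightarrow> cantor set" where
  "neg_closed P i = UNIV - (\<Union>k. basic_ball (P (prod_encode (i, k))))"

lemma mem_neg_closed: "x \<in> neg_closed P i \<longleftrightarrow> (\<forall>k. \<not> in_ball x (P (prod_encode (i, k))))"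
  by (simp add: neg_closed_def mem_basic_ball)

lemma open_basic_ball: "open (basic_ball c)"
  by (auto simp: basic_ball_def open_cylinder split: nat.splits prod.splits)

lemma closed_neg_closed: "closed (neg_closed P i)"
  unfolding neg_closed_def by (intro closed_Diff open_UN ballI open_basic_ball) simp

lemma BCT0_simps:
  "in_rep BCT0 P = Some A \<longleftrightarrow> A = neg_closed P"
  "A \<in> pdom BCT0 \<longleftrightarrow> (\<forall>i. closed (A i) \<and> interior (A i) = {})"
  "x \<in> vals BCT0 A \<longleftrightarrow> (\<forall>i. x \<notin> A i)"
  "out_rep BCT0 = cantor_rep"
  by (auto simp: BCT0_def bct_problem_def seq_rep_def closed_neg_rep_def neg_closed_def nth_seq_def
      fun_eq_iff domIff)

text \<open>
  A name of an instance of the jump is a sequence of approximations to a negative name, each entry of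
  which is eventually constant.
\<close>

lemma jump_BCT0_simps:
  "in_rep (jump BCT0) Q = Some A \<longleftrightarrow>
    (\<exists>P. (\<forall>n. eventually (\<lambda>t. Q (prod_encode (t, n)) = P n) sequentially) \<and> A = neg_closed P)"
  "A \<in> pdom (jump BCT0) \<longleftrightarrow> (\<forall>i. closed (A i) \<and> interior (A i) = {})"
  "x \<in> vals (jump BCT0) A \<longleftrightarrow> (\<forall>i. x \<notin> A i)"
  "out_rep (jump BCT0) = cantor_rep"
  using BCT0_simps
  by (auto simp: jump_def map_comp_Some_iff lim_map_eq_Some tendsto_baire nth_seq_def)

lemma one_GEN_simps:
  "in_rep one_GEN = cantor_rep" "out_rep one_GEN = cantor_rep" "pdom one_GEN = UNIV"
  "x \<in> vals one_GEN q \<longleftrightarrow> one_generic_in q x"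
  by (simp_all add: one_GEN_def)

text \<open>
  The points different from \<open>\<infinity>\<close> in the \<open>i\<close>-th sequence of a positive name.
\<close>

definition listed_points :: "baire \<Rightarrow> nat \<Rightarrow> cantor set" where
  "listed_points P i = {x. \<exists>n. P (prod_encode (i, prod_encode (n, 0))) = 0 \<and>
    (\<lambda>j. P (prod_encode (i, prod_encode (n, Suc j)))) = cantor_name x}"

lemma BCT2_simps:
  "in_rep BCT2 P = Some A \<longleftrightarrow>
    (\<forall>i n. P (prod_encode (i, prod_encode (n, 0))) = 1 \<or> P (prod_encode (i, prod_encode (n, 0))) = 0 \<and>
      (\<exists>x. (\<lambda>j. P (prod_encode (i, prod_encode (n, Suc j)))) = cantor_name x)) \<and>
    A = (\<lambda>i. closure (listed_points P i))"
  "A \<in> pdom BCT2 \<longleftrightarrow> (\<forall>i. closed (A i) \<and> interior (A i) = {})"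
  "x \<in> vals BCT2 A \<longleftrightarrow> (\<forall>i. x \<notin> A i)"
  "out_rep BCT2 = cantor_rep"
proof -
  let ?z = "\<lambda>i n. nth_seq (nth_seq P i) n"
  have z: "?z i n = (\<lambda>j. P (prod_encode (i, prod_encode (n, j))))" for i n by (simp add: nth_seq_def)
  have inf_Some: "cantor_inf_rep p = Some (Some x) \<longleftrightarrow> p 0 = 0 \<and> (\<lambda>n. p (Suc n)) = cantor_name x" for p x
    by (auto simp: cantor_inf_rep_def cantor_rep_eq_Some)
  have inf_dom: "p \<in> dom cantor_inf_rep \<longleftrightarrow> p 0 = 1 \<or> p 0 = 0 \<and> (\<exists>x. (\<lambda>n. p (Suc n)) = cantor_name x)" for p
    by (auto simp: cantor_inf_rep_def dom_def cantor_rep_eq_Some)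
  have dom: "nth_seq P i \<in> dom closed_pos_rep \<longleftrightarrow> (\<forall>n. ?z i n \<in> dom cantor_inf_rep)" for i
    by (auto simp: closed_pos_rep_def seq_rep_def dom_def)
  have val: "the (closed_pos_rep (nth_seq P i)) = closure (listed_points P i)"
    if "\<forall>n. ?z i n \<in> dom cantor_inf_rep" for i
  proof -
    have "{x. Some x \<in> range (\<lambda>n. the (cantor_inf_rep (?z i n)))} = listed_points P i"
    proof -
      have "Some x = the (cantor_inf_rep (?z i n)) \<longleftrightarrow> cantor_inf_rep (?z i n) = Some (Some x)" for x n
        using that by (metis domD option.sel)
      then show ?thesis unfolding listed_points_def image_iff inf_Some by (auto simp: z)
    qed
    then show ?thesis using that
      by (simp add: closed_pos_rep_def seq_rep_def pos_closure)
  qed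
  show "in_rep BCT2 P = Some A \<longleftrightarrow>
    (\<forall>i n. P (prod_encode (i, prod_encode (n, 0))) = 1 \<or> P (prod_encode (i, prod_encode (n, 0))) = 0 \<and>
      (\<exists>x. (\<lambda>j. P (prod_encode (i, prod_encode (n, Suc j)))) = cantor_name x)) \<and>
    A = (\<lambda>i. closure (listed_points P i))" (is "_ \<longleftrightarrow> ?V \<and> _")
  proof -
    have V: "?V \<longleftrightarrow> (\<forall>i n. ?z i n \<in> dom cantor_inf_rep)" by (simp add: inf_dom z)
    show ?thesis
      unfolding V using val by (auto simp: BCT2_def bct_problem_def seq_rep_def[of closed_pos_rep] dom)
  qed
qed (auto simp: BCT2_def bct_problem_def)

section \<open>From BCT0 to 1-GEN\<close>

definition graph_name :: "baire \<Rightarrow> baire" where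
  "graph_name P e = of_bool (P (pfst e) = psnd e)"

lemma recursive_graph_name: "recursive graph_name"
  unfolding graph_name_def[abs_def] by (intro recursive_intros)

text \<open>
  To enumerate the complement of \<open>A\<^sub>i\<close> relative to the graph \<open>q\<close> of its name, search for a pair \<open>(k, c)\<close>
  such that \<open>q\<close> confirms that the \<open>k\<close>-th entry is \<open>c\<close> and the point lies in ball \<open>c\<close>.
\<close>

lemma neg_closed_complement_ce_open:
  "\<exists>j. ce_open j (\<lambda>e. P (pfst e) = psnd e) = - neg_closed P i"
proof -
  define D where "D r n \<longleftrightarrow>
    r (2 * prod_encode (prod_encode (i, pfst n), psnd n) + 1) = 1 \<and> in_ball (\<lambda>j. r (2 * j) = 1) (psnd n)"
    for r :: baire and n
  have "decidable D" unfolding D_def[abs_def] by (intro recursive_intros)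
  then obtain j where j: "\<And>r. phi j r 0 \<noteq> None \<longleftrightarrow> (\<exists>n. D r n)" using semidecidable_phi by blast
  have "x \<in> ce_open j (\<lambda>e. P (pfst e) = psnd e) \<longleftrightarrow> x \<notin> neg_closed P i" for x
  proof -
    have D: "D (baire_pair (cantor_name x) (cantor_name (\<lambda>e. P (pfst e) = psnd e))) n
        \<longleftrightarrow> P (prod_encode (i, pfst n)) = psnd n \<and> in_ball x (psnd n)" for n
      by (simp add: D_def baire_pair_def cantor_name_def)
    show ?thesis
      unfolding ce_open_def mem_Collect_eq j D mem_neg_closed
    proof -
      have "(\<exists>n. P (prod_encode (i, pfst n)) = psnd n \<and> in_ball x (psnd n))"
        if "in_ball x (P (prod_encode (i, k)))" for k
        using that by (intro exI[of _ "prod_encode (k, P (prod_encode (i, k)))"]) simp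
      then show "(\<exists>n. P (prod_encode (i, pfst n)) = psnd n \<and> in_ball x (psnd n)) \<longleftrightarrow>
          \<not> (\<forall>k. \<not> in_ball x (P (prod_encode (i, k))))" by metis
    qed
  qed
  then show ?thesis by blast
qed

text \<open>
  No cylinder misses the dense set \<open>2\<^sup>\<nat> - A\<^sub>i\<close>, so a 1-generic point must have one that lies inside it.
\<close>

lemma BCT0_reduces_one_GEN: "reduces_by graph_name BCT0 one_GEN"
  unfolding reduces_by_def
proof (intro allI impI)
  fix P A assume A: "in_rep BCT0 P = Some A \<and> A \<in> pdom BCT0"
  define q where "q e \<longleftrightarrow> P (pfst e) = psnd e" for e
  have "x \<notin> A i" if x: "one_generic_in q x" for x i
  proof -
    obtain j where j: "ce_open j q = - neg_closed P i"
      using neg_closed_complement_ce_open unfolding q_def by blast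
    obtain n where n: "cylinder x n \<subseteq> ce_open j q \<or> cylinder x n \<inter> ce_open j q = {}"
      using x unfolding one_generic_in_def by blast
    have "cylinder x n \<inter> ce_open j q \<noteq> {}"
      using A unfolding BCT0_simps interior_empty_iff j by blast
    then show ?thesis using n mem_cylinder[of x n] A unfolding BCT0_simps j by blast
  qed
  moreover have "graph_name P = cantor_name q"
    by (simp add: fun_eq_iff graph_name_def cantor_name_def q_def)
  ultimately show "\<exists>x'. in_rep one_GEN (graph_name P) = Some x' \<and> x' \<in> pdom one_GEN \<and>
      (\<forall>p y. out_rep one_GEN p = Some y \<and> y \<in> vals one_GEN x' \<longrightarrow>
        (\<exists>z. out_rep BCT0 p = Some z \<and> z \<in> vals BCT0 A))"
    by (intro exI[of _ q]) (simp add: one_GEN_simps BCT0_simps cantor_rep_eq_Some inj_cantor_name)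
qed

section \<open>From 1-GEN to the jump of BCT0\<close>

lemma not_mem_neg_closedI: "in_ball x (P (prod_encode (i, k))) \<Longrightarrow> x \<notin> neg_closed P i"
  by (auto simp: mem_neg_closed)

text \<open>
  A decidable sufficient condition for ball \<open>c\<close> to be contained in \<open>U\<^sub>i\<^sup>q\<close>: the centre has a
  certificate not exceeding the length of the prefix that defines the ball.  The balls with this
  property cover \<open>U\<^sub>i\<^sup>q\<close>.
\<close>

definition inside_ce_open :: "baire \<Rightarrow> nat \<Rightarrow> nat \<Rightarrow> bool" where
  "inside_ce_open q i c \<longleftrightarrow> (\<exists>s<Suc (psnd (c - 1)). halts_at q i (pfst (c - 1)) s)"

text \<open>
  A negative name of the frontier of \<open>U\<^sub>i\<^sup>q\<close>: ball \<open>c\<close> is listed if it is inside \<open>U\<^sub>i\<^sup>q\<close> by the above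
  criterion or disjoint from \<open>U\<^sub>i\<^sup>q\<close>; otherwise the empty ball takes its place.
\<close>

definition frontier_limit :: "baire \<Rightarrow> nat \<Rightarrow> nat" where
  "frontier_limit q e =
    (if inside_ce_open q (pfst e) (psnd e) then psnd e
     else if \<exists>m s. in_ball (bit m) (psnd e) \<and> halts_at q (pfst e) m s then 0 else psnd e)"

text \<open>
  The approximation at time \<open>t\<close>, which takes a ball for disjoint until a counterexample below \<open>t\<close> shows up.
\<close>

definition frontier_name :: "baire \<Rightarrow> nat \<Rightarrow> nat \<Rightarrow> nat" where
  "frontier_name q t e =
    (if inside_ce_open q (pfst e) (psnd e) then psnd e
     else if \<exists>m<t. \<exists>s<t. in_ball (bit m) (psnd e) \<and> halts_at q (pfst e) m s then 0 else psnd e)"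

lemma recursive_frontier_name [recursive_intros]:
  assumes Q: "recursive (\<lambda>r e. Q r (pfst e) (psnd e))" and t: "recursive t" and e: "recursive f"
  shows "recursive (\<lambda>r e. frontier_name (Q r e) (t r e) (f r e))"
  unfolding frontier_name_def inside_ce_open_def
  by (intro recursive_intros recursive_binary[of Q, OF Q] recursive_comp[OF t] recursive_comp[OF e])

lemma frontier_name_eventually:
  "eventually (\<lambda>t. frontier_name q t e = frontier_limit q e) sequentially"
proof (cases "\<exists>m s. in_ball (bit m) (psnd e) \<and> halts_at q (pfst e) m s")
  case True
  then obtain m s where ms: "in_ball (bit m) (psnd e)" "halts_at q (pfst e) m s" by blast
  have "eventually (\<lambda>t. max m s < t) sequentially" by (rule eventually_gt_at_top)
  then show ?thesis
    by eventually_elim (use ms in \<open>auto simp: frontier_name_def frontier_limit_def\<close>)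
next
  case False
  then have "frontier_name q t e = frontier_limit q e" for t
    unfolding frontier_name_def frontier_limit_def by auto
  then show ?thesis by simp
qed

lemma inside_ce_openD:
  assumes "inside_ce_open (cantor_name q) i c" "in_ball x c"
  shows "cylinder x (psnd (c - 1)) \<subseteq> ce_open i q"
proof -
  obtain s where s: "s \<le> psnd (c - 1)" "halts_at (cantor_name q) i (pfst (c - 1)) s"
    using assms(1) by (auto simp: inside_ce_open_def less_Suc_eq_le)
  have "cylinder x (psnd (c - 1)) \<subseteq> cylinder (bit (pfst (c - 1))) s"
    using assms(2) s(1) by (auto simp: in_ball_def cylinder_def)
  then show ?thesis using halts_at_subset[OF s(2)] by blast
qed

text \<open>
  A cylinder either contains a point of \<open>U\<^sub>i\<^sup>q\<close>, and then a ball inside \<open>U\<^sub>i\<^sup>q\<close> meets it, or it is itself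
  one of the listed disjoint balls.
\<close>

lemma frontier_limit_nowhere_dense:
  "interior (neg_closed (frontier_limit (cantor_name q)) i) = {}"
  unfolding interior_empty_iff
proof (intro allI)
  fix x n
  let ?F = "frontier_limit (cantor_name q)"
  obtain m :: nat where m: "\<forall>k<n. bit m k = x k" using ex_nat_with_bits by blast
  define c where "c = Suc (prod_encode (m, n))"
  have c: "in_ball y c \<longleftrightarrow> y \<in> cylinder x n" for y
    using m by (auto simp: c_def in_ball_def cylinder_def)
  show "\<exists>y\<in>cylinder x n. y \<notin> neg_closed ?F i"
  proof (cases "\<exists>m s. in_ball (bit m) c \<and> halts_at (cantor_name q) i m s")
    case True
    then obtain m' s where m': "bit m' \<in> cylinder x n" "halts_at (cantor_name q) i m' s"
      unfolding c by blast
    define d where "d = Suc (prod_encode (m', max n s))"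
    have "?F (prod_encode (i, d)) = d"
      using m'(2) by (auto simp: frontier_limit_def inside_ce_open_def d_def less_Suc_eq_le
          intro!: exI[of _ s])
    moreover have "in_ball (bit m') d" by (simp add: d_def in_ball_def)
    ultimately have "in_ball (bit m') (?F (prod_encode (i, d)))" by simp
    then show ?thesis using m'(1) not_mem_neg_closedI by blast
  next
    case False
    then have "?F (prod_encode (i, c)) = c" by (auto simp: frontier_limit_def)
    moreover have "in_ball x c" by (simp add: c mem_cylinder)
    ultimately have "in_ball x (?F (prod_encode (i, c)))" by simp
    then show ?thesis using mem_cylinder not_mem_neg_closedI by blast
  qed
qed

lemma one_generic_if_avoids_frontiers:
  assumes "\<And>i. x \<notin> neg_closed (frontier_limit (cantor_name q)) i"
  shows "one_generic_in q x"
  unfolding one_generic_in_def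
proof
  fix i
  let ?F = "frontier_limit (cantor_name q)"
  obtain k where k: "in_ball x (?F (prod_encode (i, k)))"
    using assms[of i] by (auto simp: mem_neg_closed)
  then have nz: "?F (prod_encode (i, k)) \<noteq> 0" by (auto simp: in_ball_def)
  show "\<exists>n. cylinder x n \<subseteq> ce_open i q \<or> cylinder x n \<inter> ce_open i q = {}"
  proof (cases "inside_ce_open (cantor_name q) i k")
    case True
    then show ?thesis using inside_ce_openD[OF True] k by (auto simp: frontier_limit_def)
  next
    case False
    then have disj: "\<not> (in_ball (bit m) k \<and> halts_at (cantor_name q) i m s)" for m s
      using nz by (auto simp: frontier_limit_def split: if_splits)
    have x: "in_ball x k" using k nz by (auto simp: frontier_limit_def split: if_splits)
    have "y \<notin> ce_open i q" if y: "y \<in> cylinder x (psnd (k - 1))" for y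
    proof
      assume "y \<in> ce_open i q"
      then obtain s where s: "\<And>m. \<forall>j<s. bit m j = y j \<Longrightarrow> halts_at (cantor_name q) i m s"
        using ce_open_halts_at by blast
      obtain m :: nat where m: "\<forall>j<max s (psnd (k - 1)). bit m j = y j" using ex_nat_with_bits by blast
      have "in_ball (bit m) k" using x y m by (auto simp: in_ball_def cylinder_def)
      moreover have "halts_at (cantor_name q) i m s" using m by (intro s) auto
      ultimately show False using disj by blast
    qed
    then show ?thesis by blast
  qed
qed

definition frontier_sequence :: "baire \<Rightarrow> baire" where
  "frontier_sequence q e = frontier_name q (pfst e) (psnd e)"

lemma recursive_frontier_sequence: "recursive frontier_sequence"
  unfolding frontier_sequence_def[abs_def] by (intro recursive_intros)

lemma one_GEN_reduces_jump_BCT0: "reduces_by frontier_sequence one_GEN (jump BCT0)"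
  unfolding reduces_by_def
proof (intro allI impI)
  fix p q assume "in_rep one_GEN p = Some q \<and> q \<in> pdom one_GEN"
  then have p: "p = cantor_name q" by (simp add: one_GEN_simps cantor_rep_eq_Some)
  let ?A = "neg_closed (frontier_limit p)"
  have "in_rep (jump BCT0) (frontier_sequence p) = Some ?A"
    unfolding jump_BCT0_simps using frontier_name_eventually by (auto simp: frontier_sequence_def)
  moreover have "?A \<in> pdom (jump BCT0)"
    by (simp add: jump_BCT0_simps closed_neg_closed frontier_limit_nowhere_dense p)
  ultimately show "\<exists>x'. in_rep (jump BCT0) (frontier_sequence p) = Some x' \<and> x' \<in> pdom (jump BCT0) \<and>
      (\<forall>s y. out_rep (jump BCT0) s = Some y \<and> y \<in> vals (jump BCT0) x' \<longrightarrow>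
        (\<exists>z. out_rep one_GEN s = Some z \<and> z \<in> vals one_GEN q))"
    using one_generic_if_avoids_frontiers
    by (intro exI[of _ ?A]) (auto simp: jump_BCT0_simps one_GEN_simps p)
qed

section \<open>From BCT2 to the jump of BCT0\<close>

text \<open>
  The balls that contain no listed point form a negative name of the closure of the listed points.
  Testing \<open>= 1\<close> decodes bits that are known to be \<open>0\<close> or \<open>1\<close>.
\<close>

definition complement_limit :: "baire \<Rightarrow> baire" where
  "complement_limit P e =
    (if \<exists>n. P (prod_encode (pfst e, prod_encode (n, 0))) = 0 \<and>
         in_ball (\<lambda>j. P (prod_encode (pfst e, prod_encode (n, Suc j))) = 1) (psnd e)
     then 0 else psnd e)"

definition complement_sequence :: "baire \<Rightarrow> baire" where
  "complement_sequence P e =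
    (if \<exists>n<pfst e. P (prod_encode (pfst (psnd e), prod_encode (n, 0))) = 0 \<and>
         in_ball (\<lambda>j. P (prod_encode (pfst (psnd e), prod_encode (n, Suc j))) = 1) (psnd (psnd e))
     then 0 else psnd (psnd e))"

lemma recursive_complement_sequence: "recursive complement_sequence"
  unfolding complement_sequence_def[abs_def] by (intro recursive_intros)

lemma complement_sequence_eventually:
  "eventually (\<lambda>t. complement_sequence P (prod_encode (t, e)) = complement_limit P e) sequentially"
proof (cases "\<exists>n. P (prod_encode (pfst e, prod_encode (n, 0))) = 0 \<and>
         in_ball (\<lambda>j. P (prod_encode (pfst e, prod_encode (n, Suc j))) = 1) (psnd e)")
  case True
  then obtain n where n: "P (prod_encode (pfst e, prod_encode (n, 0))) = 0 \<and>
         in_ball (\<lambda>j. P (prod_encode (pfst e, prod_encode (n, Suc j))) = 1) (psnd e)" by blast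
  have lim: "complement_limit P e = 0" using True by (simp only: complement_limit_def if_True)
  have "eventually (\<lambda>t. n < t) sequentially" by (rule eventually_gt_at_top)
  then show ?thesis
  proof eventually_elim
    case (elim t)
    with n have "\<exists>n<t. P (prod_encode (pfst e, prod_encode (n, 0))) = 0 \<and>
         in_ball (\<lambda>j. P (prod_encode (pfst e, prod_encode (n, Suc j))) = 1) (psnd e)" by blast
    then show ?case
      unfolding lim complement_sequence_def prod_encode_inverse fst_conv snd_conv by (simp only: if_True)
  qed
next
  case False
  then have lim: "complement_limit P e = psnd e" by (simp only: complement_limit_def if_False)
  have "complement_sequence P (prod_encode (t, e)) = complement_limit P e" for t
  proof -
    have "\<not> (\<exists>n<t. P (prod_encode (pfst e, prod_encode (n, 0))) = 0 \<and>
         in_ball (\<lambda>j. P (prod_encode (pfst e, prod_encode (n, Suc j))) = 1) (psnd e))"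
      using False by blast
    then show ?thesis
      unfolding lim complement_sequence_def prod_encode_inverse fst_conv snd_conv by (simp only: if_False)
  qed
  then show ?thesis by simp
qed

lemma complement_limit_eq:
  assumes "\<And>n. P (prod_encode (i, prod_encode (n, 0))) = 1 \<or>
    P (prod_encode (i, prod_encode (n, 0))) = 0 \<and>
    (\<exists>x. (\<lambda>j. P (prod_encode (i, prod_encode (n, Suc j)))) = cantor_name x)"
  shows "neg_closed (complement_limit P) i = closure (listed_points P i)"
proof -
  have one: "(\<lambda>j. cantor_name x j = 1) = x" for x by (auto simp: cantor_name_def)
  have lim: "complement_limit P (prod_encode (i, c)) = (if \<exists>y\<in>listed_points P i. in_ball y c then 0 else c)"
    for c
  proof -
    have "(\<exists>n. P (prod_encode (i, prod_encode (n, 0))) = 0 \<and>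
         in_ball (\<lambda>j. P (prod_encode (i, prod_encode (n, Suc j))) = 1) c)
      \<longleftrightarrow> (\<exists>y\<in>listed_points P i. in_ball y c)" (is "?l \<longleftrightarrow> ?r")
    proof
      assume ?l
      then obtain n where n: "P (prod_encode (i, prod_encode (n, 0))) = 0"
        "in_ball (\<lambda>j. P (prod_encode (i, prod_encode (n, Suc j))) = 1) c" by blast
      then obtain x where x: "(\<lambda>j. P (prod_encode (i, prod_encode (n, Suc j)))) = cantor_name x"
        using assms[of n] by auto
      from x have "(\<lambda>j. P (prod_encode (i, prod_encode (n, Suc j))) = 1) = x"
        using one[of x] by (simp add: fun_eq_iff)
      then have "in_ball x c" using n(2) by simp
      then show ?r using n(1) x unfolding listed_points_def by blast
    next
      assume ?r
      then obtain x n where n: "P (prod_encode (i, prod_encode (n, 0))) = 0" "in_ball x c"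
        and x: "(\<lambda>j. P (prod_encode (i, prod_encode (n, Suc j)))) = cantor_name x"
        unfolding listed_points_def by blast
      from x have "(\<lambda>j. P (prod_encode (i, prod_encode (n, Suc j))) = 1) = x"
        using one[of x] by (simp add: fun_eq_iff)
      then show ?l using n by auto
    qed
    then show ?thesis by (simp add: complement_limit_def)
  qed
  show ?thesis
  proof (rule set_eqI)
    fix x
    have "x \<notin> neg_closed (complement_limit P) i \<longleftrightarrow> (\<exists>c. in_ball x c \<and> (\<forall>y\<in>listed_points P i. \<not> in_ball y c))"
      unfolding mem_neg_closed lim by (auto simp: in_ball_def[of _ 0])
    also have "\<dots> \<longleftrightarrow> (\<exists>n. cylinder x n \<inter> listed_points P i = {})"
    proof
      assume "\<exists>c. in_ball x c \<and> (\<forall>y\<in>listed_points P i. \<not> in_ball y c)"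
      then show "\<exists>n. cylinder x n \<inter> listed_points P i = {}"
        using in_ball_cylinder mem_basic_ball by blast
    next
      assume "\<exists>n. cylinder x n \<inter> listed_points P i = {}"
      then obtain n where n: "cylinder x n \<inter> listed_points P i = {}" by blast
      obtain c where "basic_ball c = cylinder x n" using cyl_ball by blast
      then have c: "in_ball y c \<longleftrightarrow> y \<in> cylinder x n" for y using mem_basic_ball by blast
      show "\<exists>c. in_ball x c \<and> (\<forall>y\<in>listed_points P i. \<not> in_ball y c)"
        using n mem_cylinder by (intro exI[of _ c]) (auto simp: c)
    qed
    finally show "x \<in> neg_closed (complement_limit P) i \<longleftrightarrow> x \<in> closure (listed_points P i)"
      unfolding closure_iff_cylinders by blast
  qed
qed

lemma BCT2_reduces_jump_BCT0: "reduces_by complement_sequence BCT2 (jump BCT0)"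
  unfolding reduces_by_def
proof (intro allI impI)
  fix P A assume A: "in_rep BCT2 P = Some A \<and> A \<in> pdom BCT2"
  then have "neg_closed (complement_limit P) = A"
    unfolding BCT2_simps using complement_limit_eq by blast
  then have "in_rep (jump BCT0) (complement_sequence P) = Some A"
    unfolding jump_BCT0_simps using complement_sequence_eventually by blast
  then show "\<exists>x'. in_rep (jump BCT0) (complement_sequence P) = Some x' \<and> x' \<in> pdom (jump BCT0) \<and>
      (\<forall>q y. out_rep (jump BCT0) q = Some y \<and> y \<in> vals (jump BCT0) x' \<longrightarrow>
        (\<exists>z. out_rep BCT2 q = Some z \<and> z \<in> vals BCT2 A))"
    using A by (auto simp: jump_BCT0_simps BCT2_simps)
qed

section \<open>From the jump of BCT0 to BCT2\<close>

text \<open>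
  The cylinder given by the first \<open>n\<close> bits of \<open>m\<close> is contained in ball \<open>c\<close>.  The prefix defining the ball
  must not be longer than \<open>n\<close>, so that the condition concerns the cylinder and not just the point \<open>bit m\<close>.
\<close>

definition inside_ball :: "nat \<Rightarrow> nat \<Rightarrow> nat \<Rightarrow> bool" where
  "inside_ball m n c \<longleftrightarrow> psnd (c - 1) \<le> n \<and> in_ball (bit m) c"

lemma decidable_inside_ball [recursive_intros]:
  assumes m: "recursive m" and "recursive n" "recursive c"
  shows "decidable (\<lambda>r e. inside_ball (m r e) (n r e) (c r e))"
  unfolding inside_ball_def by (intro recursive_intros assms recursive_comp[OF m])

lemma inside_ball_in_ball:
  assumes "inside_ball m n c" "\<forall>k<n. bit m k = x k" shows "in_ball x c"
  using assms by (auto simp: inside_ball_def in_ball_def)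

text \<open>
  The point \<open>bit m\<close> is listed for precision \<open>l\<close> at time \<open>t\<close>.  Here \<open>m < 2 ^ l\<close> runs through the words of length
  \<open>l\<close>, and the middle condition makes \<open>t\<close> the starting time \<open>l\<close> or a time at which one of the first \<open>l\<close>
  entries changes.  Starting only at \<open>t = l\<close> ensures that for each fixed \<open>k < l\<close> the entry \<open>k\<close>
  consulted at time \<open>t\<close> is the final one, with finitely many exceptions.
\<close>

definition kept :: "baire \<Rightarrow> nat \<Rightarrow> nat \<Rightarrow> nat \<Rightarrow> nat \<Rightarrow> bool" where
  "kept Q i l t m \<longleftrightarrow> m < 2 ^ l \<and> l \<le> t \<and>
    (t = l \<or> (\<exists>k<l. Q (prod_encode (t, prod_encode (i, k))) \<noteq> Q (prod_encode (t - 1, prod_encode (i, k))))) \<and>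
    (\<forall>k<l. \<not> inside_ball m l (Q (prod_encode (t, prod_encode (i, k)))))"

lemma decidable_kept [recursive_intros]:
  assumes i: "recursive i" and l: "recursive l" and t: "recursive t" and m: "recursive m"
  shows "decidable (\<lambda>r e. kept r (i r e) (l r e) (t r e) (m r e))"
  unfolding kept_def
  by (intro recursive_intros recursive_comp[OF i] recursive_comp[OF l] recursive_comp[OF t] recursive_comp[OF m])

text \<open>
  Entry \<open>0\<close> of the name of a point selects the summand, with value \<open>1\<close> for the point \<open>\<infinity>\<close>.
\<close>

definition kept_points :: "baire \<Rightarrow> baire" where
  "kept_points Q e =
    (let i = pfst e; n = pfst (psnd e); j = psnd (psnd e) in
     if j = 0 then of_bool (\<not> kept Q i (pfst n) (pfst (psnd n)) (psnd (psnd n)))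
     else of_bool (bit (psnd (psnd n)) (j - 1)))"

lemma recursive_kept_points: "recursive kept_points"
  unfolding kept_points_def[abs_def] Let_def by (intro recursive_intros)

lemma kept_points_name:
  "kept_points Q (prod_encode (i, prod_encode (prod_encode (l, prod_encode (t, m)), 0))) = of_bool (\<not> kept Q i l t m)"
  "(\<lambda>j. kept_points Q (prod_encode (i, prod_encode (n, Suc j)))) = cantor_name (bit (psnd (psnd n)))"
  by (auto simp: kept_points_def cantor_name_def)

lemma listed_kept_points: "listed_points (kept_points Q) i = {bit m | l t m. kept Q i l t m}"
proof -
  have zero: "kept_points Q (prod_encode (i, prod_encode (n, 0))) = 0 \<longleftrightarrow>
      kept Q i (pfst n) (pfst (psnd n)) (psnd (psnd n))" for n
    by (simp add: kept_points_def)
  have "x \<in> listed_points (kept_points Q) i \<longleftrightarrow>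
    (\<exists>n. kept Q i (pfst n) (pfst (psnd n)) (psnd (psnd n)) \<and> bit (psnd (psnd n)) = x)" for x
    unfolding listed_points_def kept_points_name mem_Collect_eq inj_cantor_name zero ..
  moreover have "(\<exists>n. kept Q i (pfst n) (pfst (psnd n)) (psnd (psnd n)) \<and> bit (psnd (psnd n)) = x) \<longleftrightarrow>
      (\<exists>l t m. x = bit m \<and> kept Q i l t m)" (is "?l \<longleftrightarrow> ?r") for x
  proof
    assume ?r
    then obtain l t m where "x = bit m" "kept Q i l t m" by blast
    then show ?l by (intro exI[of _ "prod_encode (l, prod_encode (t, m))"]) simp
  qed blast
  ultimately show ?thesis by blast
qed

lemma eventually_all_below:
  fixes N :: nat
  assumes "\<forall>n. eventually (\<lambda>t. f t n = (g n :: nat)) sequentially"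
  shows "\<exists>T. \<forall>t\<ge>T. \<forall>k<N. f t (h k) = g (h k)"
proof -
  have "eventually (\<lambda>t. \<forall>k\<in>{..<N}. f t (h k) = g (h k)) sequentially"
    using assms by (intro eventually_ball_finite) auto
  then show ?thesis by (auto simp: eventually_sequentially)
qed

text \<open>
  At the last time at which the first \<open>l\<close> entries change, they are correct.  A cylinder of length \<open>l\<close>
  around a point of \<open>A\<close> is not contained in any ball of the name, so it receives a point at that time.
\<close>

lemma neg_closed_subset_kept:
  assumes ev: "\<forall>n. eventually (\<lambda>t. Q (prod_encode (t, n)) = P n) sequentially"
  shows "neg_closed P i \<subseteq> closure {bit m | l t m. kept Q i l t m}"
proof
  fix x assume x: "x \<in> neg_closed P i"
  show "x \<in> closure {bit m | l t m. kept Q i l t m}"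
    unfolding closure_iff_cylinders
  proof
    fix l
    define st where "st T \<longleftrightarrow> l \<le> T \<and> (\<forall>t\<ge>T. \<forall>k<l. Q (prod_encode (t, prod_encode (i, k))) = P (prod_encode (i, k)))"
      for T
    obtain T where "\<forall>t\<ge>T. \<forall>k<l. Q (prod_encode (t, prod_encode (i, k))) = P (prod_encode (i, k))"
      using eventually_all_below[of "\<lambda>t n. Q (prod_encode (t, n))" P l "\<lambda>k. prod_encode (i, k)"] ev by blast
    then have "st (max T l)" by (simp add: st_def)
    then obtain t where t: "st t" "\<And>t'. t' < t \<Longrightarrow> \<not> st t'" using exists_least_iff[of st] by blast
    have change: "t = l \<or> (\<exists>k<l. Q (prod_encode (t, prod_encode (i, k))) \<noteq> Q (prod_encode (t - 1, prod_encode (i, k))))"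
    proof (rule ccontr)
      assume "\<not> ?thesis"
      then have ne: "t \<noteq> l" and
        eq: "\<forall>k<l. Q (prod_encode (t, prod_encode (i, k))) = Q (prod_encode (t - 1, prod_encode (i, k)))"
        by blast+
      then have "l \<le> t - 1" "t - 1 < t" using t(1) by (auto simp: st_def)
      moreover have "Q (prod_encode (t', prod_encode (i, k))) = P (prod_encode (i, k))"
        if "t - 1 \<le> t'" "k < l" for t' k
      proof (cases "t' = t - 1")
        case True
        then show ?thesis using eq t(1) that(2) by (auto simp: st_def)
      next
        case False
        then show ?thesis using t(1) that by (auto simp: st_def)
      qed
      ultimately show False using t(2) unfolding st_def by blast
    qed
    obtain m' :: nat where m': "\<forall>k<l. bit m' k = x k" using ex_nat_with_bits by blast
    define m where "m = take_bit l m'"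
    have m: "m < 2 ^ l" "\<forall>k<l. bit m k = x k"
      using m' by (simp_all add: m_def bit_take_bit_iff)
    have "\<not> inside_ball m l (P (prod_encode (i, k)))" for k
      using x inside_ball_in_ball[OF _ m(2)] unfolding mem_neg_closed by blast
    then have "kept Q i l t m"
      unfolding kept_def using m(1) change t(1) by (auto simp: st_def)
    moreover have "bit m \<in> cylinder x l" using m(2) by (simp add: cylinder_def)
    ultimately show "cylinder x l \<inter> {bit m | l t m. kept Q i l t m} \<noteq> {}" by blast
  qed
qed

text \<open>
  Given a cylinder, density of the complement of \<open>A\<close> provides a smaller one, around some \<open>y\<close>, inside the \<open>k\<close>-th ball
  of the name.  A point listed in it belongs to a precision \<open>l\<close> for which the \<open>k\<close>-th entry was not yet
  consulted or not yet correct; this bounds \<open>l\<close> and leaves finitely many points.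
\<close>

lemma kept_nowhere_dense:
  assumes ev: "\<forall>n. eventually (\<lambda>t. Q (prod_encode (t, n)) = P n) sequentially"
    and nd: "interior (neg_closed P i) = {}"
  shows "interior (closure {bit m | l t m. kept Q i l t m}) = {}"
  unfolding interior_empty_iff
proof (intro allI)
  fix x n
  obtain y where y: "y \<in> cylinder x n" "y \<notin> neg_closed P i"
    using nd unfolding interior_empty_iff by blast
  then obtain k where k: "in_ball y (P (prod_encode (i, k)))" by (auto simp: mem_neg_closed)
  define c where "c = P (prod_encode (i, k))"
  define n' where "n' = max n (psnd (c - 1))"
  define N where "N = max n' (Suc k)"
  obtain T where T: "\<And>t k'. T \<le> t \<Longrightarrow> k' < N \<Longrightarrow>
      Q (prod_encode (t, prod_encode (i, k'))) = P (prod_encode (i, k'))"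
    using eventually_all_below[of "\<lambda>t n. Q (prod_encode (t, n))" P N "\<lambda>k. prod_encode (i, k)"] ev by blast
  define M where "M = N + T"
  have bound: "l \<le> M" if kept: "kept Q i l t m" and m: "bit m \<in> cylinder y n'" for l t m
  proof (cases "l < N")
    case True then show ?thesis by (simp add: M_def)
  next
    case False
    then have "k < l" "psnd (c - 1) \<le> l" by (simp_all add: N_def n'_def)
    moreover have "in_ball (bit m) c"
      using k m by (auto simp: c_def n'_def in_ball_def cylinder_def)
    ultimately have "Q (prod_encode (t, prod_encode (i, k))) \<noteq> c"
      using kept by (auto simp: kept_def inside_ball_def)
    then have "t < T" using T[of t k] by (fastforce simp: c_def N_def)
    then show ?thesis using kept by (simp add: kept_def M_def)
  qed
  \<comment> \<open>A sequence ending in ones differs from each of the finitely many points \<open>bit m\<close> at position \<open>max n' M\<close>.\<close>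
  define y' where "y' k = (if k < n' then y k else True)" for k
  have "cylinder y' (Suc (max n' M)) \<inter> {bit m | l t m. kept Q i l t m} = {}"
  proof (rule ccontr)
    assume "\<not> ?thesis"
    then obtain m l t where m: "bit m \<in> cylinder y' (Suc (max n' M))" "kept Q i l t m" by auto
    have "bit m \<in> cylinder y n'" using m(1) by (auto simp: cylinder_def y'_def)
    then have "l \<le> max n' M" using bound[OF m(2)] by simp
    then have "(2::nat) ^ l \<le> 2 ^ max n' M" by (intro power_increasing) simp_all
    moreover have "m < 2 ^ l" using m(2) by (simp add: kept_def)
    ultimately have "m < 2 ^ max n' M" by linarith
    then have "\<not> bit m (max n' M)" by (simp add: bit_iff_odd)
    then show False using m(1) by (auto simp: cylinder_def y'_def)
  qed
  then have "y' \<notin> closure {bit m | l t m. kept Q i l t m}" unfolding closure_iff_cylinders by blast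
  moreover have "y' \<in> cylinder x n" using y(1) by (simp add: y'_def cylinder_def n'_def less_max_iff_disj)
  ultimately show "\<exists>y\<in>cylinder x n. y \<notin> closure {bit m | l t m. kept Q i l t m}" by blast
qed

lemma jump_BCT0_reduces_BCT2: "reduces_by kept_points (jump BCT0) BCT2"
  unfolding reduces_by_def
proof (intro allI impI)
  fix Q A assume A: "in_rep (jump BCT0) Q = Some A \<and> A \<in> pdom (jump BCT0)"
  then obtain P where ev: "\<forall>n. eventually (\<lambda>t. Q (prod_encode (t, n)) = P n) sequentially"
    and P: "A = neg_closed P"
    unfolding jump_BCT0_simps by blast
  let ?B = "\<lambda>i. closure {bit m | l t m. kept Q i l t m}"
  have "in_rep BCT2 (kept_points Q) = Some ?B"
  proof -
    have "kept_points Q (prod_encode (i, prod_encode (n, 0))) = 1 \<or>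
        kept_points Q (prod_encode (i, prod_encode (n, 0))) = 0" for i n
      by (simp add: kept_points_def)
    then show ?thesis unfolding BCT2_simps listed_kept_points kept_points_name inj_cantor_name by blast
  qed
  moreover have "?B \<in> pdom BCT2"
    using A kept_nowhere_dense[OF ev] by (simp add: BCT2_simps jump_BCT0_simps P)
  moreover have "A i \<subseteq> ?B i" for i
    unfolding P by (rule neg_closed_subset_kept[OF ev])
  ultimately show "\<exists>x'. in_rep BCT2 (kept_points Q) = Some x' \<and> x' \<in> pdom BCT2 \<and>
      (\<forall>q y. out_rep BCT2 q = Some y \<and> y \<in> vals BCT2 x' \<longrightarrow>
        (\<exists>z. out_rep (jump BCT0) q = Some z \<and> z \<in> vals (jump BCT0) A))"
    by (intro exI[of _ ?B]) (auto simp: BCT2_simps(3,4) jump_BCT0_simps(3,4))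
qed

section \<open>Limit computation of points in dense open sets\<close>

text \<open>
  A candidate \<open>c\<close> codes \<open>(k, (m, n))\<close>: the word given by the first \<open>n\<close> bits of \<open>m\<close> extends the word \<open>w\<close>, is longer
  than \<open>i\<close>, and its cylinder lies in the \<open>k\<close>-th ball of the complement of \<open>A\<^sub>i\<close>.
\<close>

definition extension :: "baire \<Rightarrow> nat \<Rightarrow> nat \<Rightarrow> nat \<Rightarrow> bool" where
  "extension P i w c \<longleftrightarrow>
    psnd w \<le> psnd (psnd c) \<and> i < psnd (psnd c) \<and>
    (\<forall>j<psnd w. bit (pfst (psnd c)) j = bit (pfst w) j) \<and>
    inside_ball (pfst (psnd c)) (psnd (psnd c)) (P (prod_encode (i, pfst c)))"

text \<open>
  The word after the first \<open>i\<close> requirements have been met, each by the least suitable candidate, where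
  only candidates below \<open>t\<close> are considered.  As for \<open>bounded_search\<close>, \<open>0\<close> signals failure and words are
  shifted by one.
\<close>

primrec stage :: "baire \<Rightarrow> nat \<Rightarrow> nat \<Rightarrow> nat" where
  "stage P t 0 = Suc (prod_encode (0, 0))"
| "stage P t (Suc i) =
    (if stage P t i = 0 \<or> bounded_search (extension P i (stage P t i - 1)) t = 0 then 0
     else Suc (psnd (bounded_search (extension P i (stage P t i - 1)) t - 1)))"

lemma stage_rec_nat:
  "stage P t i = rec_nat (Suc (prod_encode (0, 0)))
    (\<lambda>i u. if u = 0 \<or> bounded_search (extension P i (u - 1)) t = 0 then 0
      else Suc (psnd (bounded_search (extension P i (u - 1)) t - 1))) i"
  by (induction i) simp_all

lemma recursive_stage [recursive_intros]:
  assumes P: "recursive (\<lambda>r e. P r (pfst e) (psnd e))" and t: "recursive t" and "recursive i"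
  shows "recursive (\<lambda>r e. stage (P r e) (t r e) (i r e))"
  unfolding stage_rec_nat extension_def
  by (intro recursive_intros recursive_binary[of P, OF P] recursive_comp[OF t] assms(3))

lemma bounded_search_eq_Suc:
  "bounded_search P b = Suc c \<longleftrightarrow> c < b \<and> P c \<and> (\<forall>d<c. \<not> P d)"
proof
  assume *: "bounded_search P b = Suc c"
  have ex: "\<exists>d<b. P d"
  proof (rule ccontr)
    assume "\<not> (\<exists>d<b. P d)"
    then have "bounded_search P b = 0" by (simp only: bounded_search_eq if_False)
    then show False using * by simp
  qed
  then have c: "c = (LEAST c. P c)" using * by (simp only: bounded_search_eq if_True nat.inject)
  from ex obtain d where d: "d < b" "P d" by blast
  have "c \<le> d" "P c" unfolding c using d(2) by (rule Least_le, rule LeastI)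
  moreover have "\<not> P d'" if "d' < c" for d' using that unfolding c by (rule not_less_Least)
  ultimately show "c < b \<and> P c \<and> (\<forall>d<c. \<not> P d)" using d(1) by auto
next
  assume *: "c < b \<and> P c \<and> (\<forall>d<c. \<not> P d)"
  then have "(LEAST c. P c) = c" 
  proof (intro Least_equality)
    fix d assume "P d"
    then have "\<not> d < c" using * by blast
    then show "c \<le> d" by simp
  qed blast
  moreover have "\<exists>c<b. P c" using * by blast
  ultimately show "bounded_search P b = Suc c" by (simp only: bounded_search_eq if_True)
qed

lemma bounded_search_cong:
  assumes "\<And>c. c < b \<Longrightarrow> P c = Q c" shows "bounded_search P b = bounded_search Q b"
  using assms by (induction b) (simp_all add: bounded_search_def)

lemma stage_Suc_eq_Suc:
  "stage P t (Suc i) = Suc w' \<longleftrightarrow> (\<exists>w c. stage P t i = Suc w \<and> w' = psnd c \<and> c < t \<and>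
    extension P i w c \<and> (\<forall>d<c. \<not> extension P i w d))"
proof -
  have "stage P t (Suc i) = Suc w' \<longleftrightarrow>
    (\<exists>w c. stage P t i = Suc w \<and> bounded_search (extension P i w) t = Suc c \<and> w' = psnd c)"
  proof (cases "stage P t i")
    case (Suc w)
    then show ?thesis by (cases "bounded_search (extension P i w) t") auto
  qed simp
  then show ?thesis unfolding bounded_search_eq_Suc by blast
qed

text \<open>
  A success is final, because the least candidate does not depend on the bound.
\<close>

lemma stage_mono: "stage P t i = Suc w \<Longrightarrow> t \<le> t' \<Longrightarrow> stage P t' i = Suc w"
proof (induction i arbitrary: w)
  case (Suc i)
  from Suc.prems(1) obtain u c where "stage P t i = Suc u" "w = psnd c" "c < t" "extension P i u c"
    "\<forall>d<c. \<not> extension P i u d"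
    unfolding stage_Suc_eq_Suc by blast
  moreover from this have "stage P t' i = Suc u" using Suc by blast
  ultimately show ?case using Suc.prems(2) unfolding stage_Suc_eq_Suc
    by (intro exI[of _ u] exI[of _ c]) simp
qed simp

lemma stage_continuous:
  "\<exists>F. finite F \<and> (\<forall>P'. (\<forall>n\<in>F. P' n = P n) \<longrightarrow> stage P' t i = stage P t i)"
proof (induction i)
  case 0 show ?case by (rule exI[of _ "{}"]) simp
next
  case (Suc i)
  then obtain F where F: "finite F" "\<And>P'. \<forall>n\<in>F. P' n = P n \<Longrightarrow> stage P' t i = stage P t i" by blast
  define F' where "F' = F \<union> (\<lambda>c. prod_encode (i, pfst c)) ` {..<t}"
  have "stage P' t (Suc i) = stage P t (Suc i)" if P': "\<forall>n\<in>F'. P' n = P n" for P'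
  proof -
    have "P' (prod_encode (i, pfst c)) = P (prod_encode (i, pfst c))" if "c < t" for c
      using P' that by (auto simp: F'_def)
    then have "extension P' i w c = extension P i w c" if "c < t" for w c
      using that by (simp add: extension_def)
    then have "bounded_search (extension P' i w) t = bounded_search (extension P i w) t" for w
      by (intro bounded_search_cong) blast
    moreover have "stage P' t i = stage P t i" using P' by (intro F(2)) (auto simp: F'_def)
    ultimately show ?thesis by simp
  qed
  moreover have "finite F'" using F(1) by (simp add: F'_def)
  ultimately show ?case by blast
qed

text \<open>
  Density of the complements is what guarantees candidates.
\<close>

lemma stage_exists:
  assumes nd: "\<And>i. interior (neg_closed P i) = {}"
  shows "\<exists>t w. stage P t i = Suc w"
proof (induction i)
  case (Suc i)
  then obtain t w where tw: "stage P t i = Suc w" by blast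
  obtain y where y: "y \<in> cylinder (bit (pfst w)) (psnd w)" "y \<notin> neg_closed P i"
    using nd[of i] unfolding interior_empty_iff by blast
  then obtain k where k: "in_ball y (P (prod_encode (i, k)))" by (auto simp: mem_neg_closed)
  define n where "n = psnd w + Suc i + psnd (P (prod_encode (i, k)) - 1)"
  obtain m :: nat where m: "\<forall>j<n. bit m j = y j" using ex_nat_with_bits by blast
  have ext: "extension P i w (prod_encode (k, prod_encode (m, n)))"
    using y(1) k m by (auto simp: extension_def inside_ball_def in_ball_def cylinder_def n_def)
  then obtain c where c: "extension P i w c" "\<And>d. d < c \<Longrightarrow> \<not> extension P i w d"
    using exists_least_iff[of "extension P i w"] by blast
  have "stage P (max t (Suc c)) i = Suc w" using stage_mono[OF tw] by simp
  then have "stage P (max t (Suc c)) (Suc i) = Suc (psnd c)"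
    unfolding stage_Suc_eq_Suc using c by (intro exI[of _ w] exI[of _ c]) auto
  then show ?case by blast
qed simp

lemma stage_prefix:
  assumes "stage P t i' = Suc w'" "i \<le> i'"
  shows "\<exists>w. stage P t i = Suc w \<and> psnd w \<le> psnd w' \<and> (\<forall>j<psnd w. bit (pfst w') j = bit (pfst w) j)"
  using assms(2,1)
proof (induction i' arbitrary: w' rule: dec_induct)
  case (step i')
  from step.prems obtain u c where uc: "stage P t i' = Suc u" "w' = psnd c" "extension P i' u c"
    unfolding stage_Suc_eq_Suc by blast
  from step.IH[OF uc(1)] obtain w where w: "stage P t i = Suc w" "psnd w \<le> psnd u"
    "\<forall>j<psnd w. bit (pfst u) j = bit (pfst w) j" by blast
  then show ?case using uc(2,3) by (intro exI[of _ w]) (simp add: extension_def)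
qed auto

definition approximation :: "baire \<Rightarrow> nat \<Rightarrow> cantor" where
  "approximation P t n \<longleftrightarrow> stage P t (Suc n) \<noteq> 0 \<and> bit (pfst (stage P t (Suc n) - 1)) n"

lemma decidable_approximation [recursive_intros]:
  assumes P: "recursive (\<lambda>r e. P r (pfst e) (psnd e))" and t: "recursive t" and n: "recursive n"
  shows "decidable (\<lambda>r e. approximation (P r e) (t r e) (n r e))"
  unfolding approximation_def
  by (intro recursive_intros recursive_binary[of P, OF P] t n)

text \<open>
  The words of the successive stages are prefixes of one point, and the \<open>n\<close>-th bit can be read off
  any successful stage \<open>n + 1\<close>.
\<close>

lemma approximation_limit:
  assumes nd: "\<And>i. interior (neg_closed P i) = {}"
  shows "\<exists>x. (\<forall>i. x \<notin> neg_closed P i) \<and> (\<forall>t n. stage P t (Suc n) \<noteq> 0 \<longrightarrow> approximation P t n = x n)"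
proof -
  obtain T W where TW: "\<And>i. stage P (T i) i = Suc (W i)" using stage_exists[OF nd] by metis
  define x where "x n = bit (pfst (W (Suc n))) n" for n
  have unique: "w = W i" if "stage P t i = Suc w" for t i w
    using stage_mono[OF that, of "max t (T i)"] stage_mono[OF TW, of i "max t (T i)"] by simp
  have len: "i < psnd (W (Suc i))" for i
    using TW[of "Suc i"] unfolding stage_Suc_eq_Suc by (auto simp: extension_def)
  have prefix: "bit (pfst (W i')) j = bit (pfst (W i)) j" if "i \<le> i'" "j < psnd (W i)" for i i' j
    using stage_prefix[OF TW that(1)] unique that(2) by metis
  have x: "bit (pfst (W i)) j = x j" if "j < psnd (W i)" for i j
  proof (cases "i \<le> Suc j")
    case True
    then show ?thesis using prefix[OF True that] by (simp add: x_def)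
  next
    case False
    then have "Suc j \<le> i" by simp
    from prefix[OF this len] show ?thesis by (simp add: x_def)
  qed
  have "x \<notin> neg_closed P i" for i
  proof -
    obtain c where "W (Suc i) = psnd c" "\<exists>w. extension P i w c"
      using TW[of "Suc i"] unfolding stage_Suc_eq_Suc by blast
    then have "inside_ball (pfst (W (Suc i))) (psnd (W (Suc i))) (P (prod_encode (i, pfst c)))"
      by (auto simp: extension_def)
    then have "in_ball x (P (prod_encode (i, pfst c)))"
      using x by (intro inside_ball_in_ball) auto
    then show ?thesis by (rule not_mem_neg_closedI)
  qed
  moreover have "approximation P t n = x n" if nz: "stage P t (Suc n) \<noteq> 0" for t n
  proof -
    obtain w where "stage P t (Suc n) = Suc w" using not0_implies_Suc[OF nz] by blast
    then show ?thesis using unique by (simp add: approximation_def x_def del: stage.simps)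
  qed
  ultimately show ?thesis by blast
qed

text \<open>
  A successful stage for the true name \<open>P\<close> uses finitely many entries.  Once the approximations agree
  with \<open>P\<close> there, they reproduce it, and they keep it for all larger bounds.
\<close>

lemma approximations_converge:
  assumes nd: "\<And>i. interior (neg_closed P i) = {}"
    and ev: "\<forall>n. eventually (\<lambda>t. Q t n = P n) sequentially"
  shows "\<exists>x. (\<forall>i. x \<notin> neg_closed P i) \<and>
    (\<forall>n. eventually (\<lambda>t. approximation (Q t) t n = x n) sequentially)"
proof -
  obtain x where x: "\<And>i. x \<notin> neg_closed P i"
    "\<And>t n. stage P t (Suc n) \<noteq> 0 \<Longrightarrow> approximation P t n = x n"
    using approximation_limit[OF nd] by blast
  have "eventually (\<lambda>t. approximation (Q t) t n = x n) sequentially" for n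
  proof -
    obtain T w where T: "stage P T (Suc n) = Suc w" using stage_exists[OF nd] by blast
    obtain F where F: "finite F" "\<And>P'. \<forall>k\<in>F. P' k = P k \<Longrightarrow> stage P' T (Suc n) = stage P T (Suc n)"
      using stage_continuous[of P T "Suc n"] by blast
    have "eventually (\<lambda>t. \<forall>k\<in>F. Q t k = P k) sequentially"
      using F(1) ev by (intro eventually_ball_finite) auto
    then show ?thesis using eventually_ge_at_top[of T]
    proof eventually_elim
      case (elim t)
      have "stage (Q t) T (Suc n) = Suc w" using F(2)[OF elim(1)] T by (simp del: stage.simps)
      then have "stage (Q t) t (Suc n) = Suc w" by (rule stage_mono) (rule elim)
      then have "approximation (Q t) t n = approximation P T n"
        using T by (simp add: approximation_def del: stage.simps)
      then show ?case using x(2) T by (simp del: stage.simps)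
    qed
  qed
  with x(1) show ?thesis by blast
qed

section \<open>From the jump of BCT0 to lim_J\<close>

text \<open>
  For each program, a cylinder around a 1-generic point decides whether the program halts, so that the
  corresponding bit of the jump is constant on this cylinder.
\<close>

lemma limitin_jump_topology:
  assumes x: "one_generic_in q x" and ev: "\<forall>n. eventually (\<lambda>t. X t n = x n) sequentially"
  shows "limitin jump_topology (\<lambda>t. cantor_name (X t)) (cantor_name x) sequentially"
proof -
  have "eventually (\<lambda>t. turing_jump (cantor_name (X t)) i = turing_jump (cantor_name x) i) sequentially" for i
  proof -
    obtain g where g: "\<And>r n. run g r n = Some (r (2 * n))"
    proof -
      have "recursive (\<lambda>r n. r (2 * n))" by (intro recursive_intros)
      then show ?thesis using that unfolding recursive_def by blast
    qed
    obtain j where j: "prog_of_nat j = subst_oracle g (prog_of_nat i)"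
      using surj_prog_of_nat by (metis surjD)
    have "phi j (baire_pair (cantor_name y) r) 0 = phi i (cantor_name y) 0" for y r
      unfolding phi_def j by (rule run_subst_oracle) (simp add: g baire_pair_def)
    then have ce: "y \<in> ce_open j q \<longleftrightarrow> phi i (cantor_name y) 0 \<noteq> None" for y
      by (simp add: ce_open_def)
    obtain n where n: "cylinder x n \<subseteq> ce_open j q \<or> cylinder x n \<inter> ce_open j q = {}"
      using x unfolding one_generic_in_def by blast
    have "eventually (\<lambda>t. \<forall>k\<in>{..<n}. X t k = x k) sequentially"
      using ev by (intro eventually_ball_finite) auto
    then show ?thesis
    proof eventually_elim
      case (elim t)
      then have "X t \<in> cylinder x n" by (simp add: cylinder_def)
      then have "X t \<in> ce_open j q \<longleftrightarrow> x \<in> ce_open j q" using n mem_cylinder[of x n] by blast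
      then show ?case by (simp add: turing_jump_def ce)
    qed
  qed
  then have lim: "(\<lambda>t. turing_jump (cantor_name (X t))) \<longlonglongrightarrow> turing_jump (cantor_name x)"
    by (simp add: tendsto_baire)
  show ?thesis
    unfolding limitin_def jump_topology_def topspace_pullback_topology openin_pullback_topology
    using lim by (auto simp: tendsto_def)
qed

text \<open>
  Even positions carry the given sets, odd positions the frontiers of the sets that are c.e. open in
  the zero sequence.
\<close>

definition interleaved :: "baire \<Rightarrow> nat \<Rightarrow> nat \<Rightarrow> nat" where
  "interleaved Q t e =
    (if even (pfst e) then Q (prod_encode (t, prod_encode (pfst e div 2, psnd e)))
     else frontier_name (cantor_name (\<lambda>_. False)) t (prod_encode (pfst e div 2, psnd e)))"

definition generic_approximations :: "baire \<Rightarrow> baire" where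
  "generic_approximations Q e = cantor_name (approximation (interleaved Q (pfst e)) (pfst e)) (psnd e)"

lemma recursive_generic_approximations: "recursive generic_approximations"
  unfolding generic_approximations_def[abs_def] interleaved_def[abs_def] by (intro recursive_intros)

lemma generic_approximations_limit:
  assumes ev: "\<forall>n. eventually (\<lambda>t. Q (prod_encode (t, n)) = P n) sequentially"
    and nd: "\<And>i. interior (neg_closed P i) = {}"
  shows "\<exists>x. (\<forall>i. x \<notin> neg_closed P i) \<and> one_generic_in (\<lambda>_. False) x \<and>
    lim_map (generic_approximations Q) = Some (cantor_name x) \<and>
    generic_approximations Q \<in> pdom lim_J"
proof -
  let ?F = "frontier_limit (cantor_name (\<lambda>_. False))"
  define R where "R e = (if even (pfst e) then P (prod_encode (pfst e div 2, psnd e))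
     else ?F (prod_encode (pfst e div 2, psnd e)))" for e
  have R: "neg_closed R (2 * i) = neg_closed P i" "neg_closed R (Suc (2 * i)) = neg_closed ?F i" for i
    by (auto simp: neg_closed_def R_def)
  have "interior (neg_closed R i) = {}" for i
  proof (cases "even i")
    case True
    then show ?thesis using R(1)[of "i div 2"] nd by simp
  next
    case False
    then show ?thesis using R(2)[of "i div 2"] frontier_limit_nowhere_dense by simp
  qed
  moreover have "\<forall>e. eventually (\<lambda>t. interleaved Q t e = R e) sequentially"
    using ev frontier_name_eventually by (simp add: interleaved_def R_def)
  ultimately obtain x where x: "\<And>i. x \<notin> neg_closed R i"
    and lim: "\<forall>n. eventually (\<lambda>t. approximation (interleaved Q t) t n = x n) sequentially"
    using approximations_converge[of R "interleaved Q"] by blast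
  have gen: "one_generic_in (\<lambda>_. False) x"
    by (rule one_generic_if_avoids_frontiers) (use x R(2) in blast)
  have seq: "nth_seq (generic_approximations Q) = (\<lambda>t. cantor_name (approximation (interleaved Q t) t))"
    by (simp add: fun_eq_iff nth_seq_def generic_approximations_def)
  have "nth_seq (generic_approximations Q) \<longlonglongrightarrow> cantor_name x"
    unfolding tendsto_baire seq
  proof
    fix n
    from lim have "eventually (\<lambda>t. approximation (interleaved Q t) t n = x n) sequentially" by blast
    then show "eventually (\<lambda>t. cantor_name (approximation (interleaved Q t) t) n = cantor_name x n) sequentially"
      by eventually_elim (simp add: cantor_name_def)
  qed
  then have "lim_map (generic_approximations Q) = Some (cantor_name x)" by (simp add: lim_map_eq_Some)
  moreover from this have "generic_approximations Q \<in> pdom lim_J"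
    using limitin_jump_topology[OF gen lim] by (auto simp: lim_J_def seq)
  ultimately show ?thesis using x R(1) gen by blast
qed

lemma jump_BCT0_reduces_lim_J: "reduces_by generic_approximations (jump BCT0) lim_J"
  unfolding reduces_by_def
proof (intro allI impI)
  fix Q A assume A: "in_rep (jump BCT0) Q = Some A \<and> A \<in> pdom (jump BCT0)"
  then obtain P where ev: "\<forall>n. eventually (\<lambda>t. Q (prod_encode (t, n)) = P n) sequentially"
    and P: "A = neg_closed P"
    unfolding jump_BCT0_simps by blast
  then obtain x where x: "\<forall>i. x \<notin> neg_closed P i"
    "lim_map (generic_approximations Q) = Some (cantor_name x)" "generic_approximations Q \<in> pdom lim_J"
    using generic_approximations_limit[OF ev] A unfolding jump_BCT0_simps by blast
  then have "(\<forall>q y. out_rep lim_J q = Some y \<and> y \<in> vals lim_J (generic_approximations Q) \<longrightarrow>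
        (\<exists>z. out_rep (jump BCT0) q = Some z \<and> z \<in> vals (jump BCT0) A))"
    by (simp add: lim_J_def baire_rep_def jump_BCT0_simps P cantor_rep_eq_Some inj_cantor_name)
  then show "\<exists>x'. in_rep lim_J (generic_approximations Q) = Some x' \<and> x' \<in> pdom lim_J \<and>
      (\<forall>q y. out_rep lim_J q = Some y \<and> y \<in> vals lim_J x' \<longrightarrow>
        (\<exists>z. out_rep (jump BCT0) q = Some z \<and> z \<in> vals (jump BCT0) A))"
    using x(3) by (intro exI[of _ "generic_approximations Q"]) (simp add: lim_J_def baire_rep_def)
qed

section \<open>Computable instances\<close>

text \<open>
  A point \<open>p\<close> is computable exactly if the functional with constant value \<open>p\<close> is recursive; this is how computable points are expressed from here on.
\<close>

lemma recursive_phi: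
  assumes "recursive (\<lambda>r. p)" "\<And>n. phi i p n = Some (q n)"
  shows "recursive (\<lambda>r. q)"
proof -
  obtain g where g: "\<forall>r n. run g r n = Some (p n)" using assms(1) unfolding recursive_def by blast
  have "run (subst_oracle g (prog_of_nat i)) r n = Some (q n)" for r n
    using run_subst_oracle[of g r p "prog_of_nat i" n] g assms(2) by (simp add: phi_def)
  then show ?thesis unfolding recursive_def by blast
qed

lemma recursive_Least:
  assumes "decidable (\<lambda>r e. D (pfst e) (psnd e))" "\<And>n. \<exists>t. D n t"
  shows "recursive (\<lambda>r n. LEAST t. D n t)"
proof -
  have "recursive (\<lambda>r e. if D (pfst e) (psnd e) then 0 else 1)" by (intro recursive_intros assms)
  then obtain c where c: "\<And>r e. run c r e = Some (if D (pfst e) (psnd e) then 0 else 1)"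
    unfolding recursive_def by blast
  have zero: "run c r (prod_encode (n, t)) = Some 0 \<longleftrightarrow> D n t"
    and pos: "(\<exists>v. run c r (prod_encode (n, t)) = Some (Suc v)) \<longleftrightarrow> \<not> D n t" for r n t
    by (simp_all add: c)
  have "\<exists>t. D n t \<and> (\<forall>s<t. \<not> D n s)" for n using assms(2) exists_least_iff[of "D n"] by blast
  then have "run (PMu c) r n = Some (LEAST t. D n t)" for r n
    unfolding run.simps zero pos by (simp only: if_True)
  then show ?thesis unfolding recursive_def by blast
qed

text \<open>
  A reduction, expressed for the individual solutions of the target instance: any solution of a
  single instance extends to a realizer, so the programs behind \<open>K\<close> and \<open>H\<close> must cope with it.  The name
  produced by \<open>K\<close> belongs to the domain, since otherwise a realizer could be undefined there.
\<close>

lemma weihrauch_leE: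
  assumes "f \<le>\<^sub>W g"
    and solvable: "\<And>x. x \<in> pdom g \<Longrightarrow> \<exists>q y. out_rep g q = Some y \<and> y \<in> vals g x"
  obtains k h where "\<And>p x. in_rep f p = Some x \<Longrightarrow> x \<in> pdom f \<Longrightarrow>
    \<exists>s x'. (\<forall>n. phi k p n = Some (s n)) \<and> in_rep g s = Some x' \<and> x' \<in> pdom g \<and>
      (\<forall>q y. out_rep g q = Some y \<and> y \<in> vals g x' \<longrightarrow>
        (\<exists>u z. (\<forall>n. phi h (baire_pair p q) n = Some (u n)) \<and> out_rep f u = Some z \<and> z \<in> vals f x))"
proof -
  obtain K H where KH: "computable K" "computable H"
    "\<And>G. G \<turnstile>\<^sub>r g \<Longrightarrow> (\<lambda>p. Option.bind ((G \<circ>\<^sub>m K) p) (\<lambda>q. H (baire_pair p q))) \<turnstile>\<^sub>r f"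
    using assms(1) unfolding weihrauch_le_def by blast
  obtain k where k: "\<And>p s n. K p = Some s \<Longrightarrow> phi k p n = Some (s n)"
    using KH(1) unfolding computable_def by blast
  obtain h where h: "\<And>p s n. H p = Some s \<Longrightarrow> phi h p n = Some (s n)"
    using KH(2) unfolding computable_def by blast
  define good where "good s q \<longleftrightarrow> (\<exists>x y. in_rep g s = Some x \<and> x \<in> pdom g \<and> out_rep g q = Some y \<and> y \<in> vals g x)"
    for s q
  define G where "G s = (if \<exists>q. good s q then Some (SOME q. good s q) else None)" for s
  have Some_G: "good s q" if "G s = Some q" for s q
  proof (cases "\<exists>q. good s q")
    case True
    then have "q = (SOME q. good s q)" using that by (simp add: G_def)
    then show ?thesis using someI_ex[OF True] by simp
  next
    case False
    then show ?thesis using that by (simp add: G_def)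
  qed
  have total: "\<exists>q. good s q" if "in_rep g s = Some x" "x \<in> pdom g" for s x
    using solvable[OF that(2)] that unfolding good_def by blast
  have G: "G(s \<mapsto> q) \<turnstile>\<^sub>r g" if "good s q" for s q
    unfolding realizes_def
  proof (intro allI impI)
    fix p x assume x: "in_rep g p = Some x \<and> x \<in> pdom g"
    obtain u where u: "(G(s \<mapsto> q)) p = Some u" "good p u"
    proof (cases "p = s")
      case True then show ?thesis using that \<open>good s q\<close> by simp
    next
      case False
      obtain u where "G p = Some u" using total x unfolding G_def by auto
      then show ?thesis using that False Some_G by simp
    qed
    then show "\<exists>u y. (G(s \<mapsto> q)) p = Some u \<and> out_rep g u = Some y \<and> y \<in> vals g x"
      using x unfolding good_def by auto
  qed
  have G0: "G \<turnstile>\<^sub>r g"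
    unfolding realizes_def
  proof (intro allI impI)
    fix p x assume x: "in_rep g p = Some x \<and> x \<in> pdom g"
    obtain u where "G p = Some u" using total x unfolding G_def by auto
    moreover from Some_G[OF this] obtain y where "out_rep g u = Some y \<and> y \<in> vals g x"
      using x unfolding good_def by auto
    ultimately show "\<exists>u y. G p = Some u \<and> out_rep g u = Some y \<and> y \<in> vals g x" by blast
  qed
  have main: "\<exists>s x'. (\<forall>n. phi k p n = Some (s n)) \<and> in_rep g s = Some x' \<and> x' \<in> pdom g \<and>
      (\<forall>q y. out_rep g q = Some y \<and> y \<in> vals g x' \<longrightarrow>
        (\<exists>u z. (\<forall>n. phi h (baire_pair p q) n = Some (u n)) \<and> out_rep f u = Some z \<and> z \<in> vals f x))"
    if px: "in_rep f p = Some x" "x \<in> pdom f" for p x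
  proof -
    from KH(3)[OF G0] px obtain u where "Option.bind ((G \<circ>\<^sub>m K) p) (\<lambda>q. H (baire_pair p q)) = Some u"
      unfolding realizes_def by blast
    then obtain s q where s: "K p = Some s" and "G s = Some q"
      by (auto simp: bind_eq_Some_conv map_comp_Some_iff)
    from Some_G[OF this(2)] obtain x' where x': "in_rep g s = Some x'" "x' \<in> pdom g"
      unfolding good_def by blast
    have "\<exists>u z. (\<forall>n. phi h (baire_pair p q) n = Some (u n)) \<and> out_rep f u = Some z \<and> z \<in> vals f x"
      if q: "out_rep g q = Some y" "y \<in> vals g x'" for q y
    proof -
      have "good s q" using x' q unfolding good_def by blast
      from KH(3)[OF G[OF this]] px obtain u z
        where "Option.bind ((G(s \<mapsto> q) \<circ>\<^sub>m K) p) (\<lambda>q. H (baire_pair p q)) = Some u"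
          "out_rep f u = Some z" "z \<in> vals f x"
        unfolding realizes_def by blast
      moreover from this(1) s have "H (baire_pair p q) = Some u"
        by (simp add: bind_eq_Some_conv map_comp_Some_iff)
      ultimately show ?thesis using h by blast
    qed
    then show ?thesis using s k x' by blast
  qed
  show ?thesis by (rule that[of k h]) (rule main)
qed

lemma BCT_solvable:
  assumes "A \<in> pdom (bct_problem \<delta>)"
  shows "\<exists>q y. cantor_rep q = Some y \<and> y \<in> vals (bct_problem \<delta>) A"
  using bct_vals_nonempty[OF assms] by (auto simp: cantor_rep_eq_Some)

text \<open>
  The complement of a computable point is c.e. open and meets every cylinder, but does not contain the point.
\<close>

lemma one_generic_not_computable:
  assumes "one_generic_in q x" shows "\<not> recursive (\<lambda>r. cantor_name x)"
proof
  assume "recursive (\<lambda>r. cantor_name x)"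
  then have "decidable (\<lambda>r n. r (2 * n) \<noteq> cantor_name x n)"
    by (intro decidable_not decidable_eq recursive_oracle recursive_mult recursive_const recursive_id)
  from semidecidable_phi[OF this]
  obtain j where j: "\<forall>r. phi j r 0 \<noteq> None \<longleftrightarrow> (\<exists>n. r (2 * n) \<noteq> cantor_name x n)" ..
  have U: "y \<in> ce_open j q \<longleftrightarrow> y \<noteq> x" for y
  proof -
    have "y \<in> ce_open j q \<longleftrightarrow> (\<exists>n. cantor_name y n \<noteq> cantor_name x n)"
      unfolding ce_open_def mem_Collect_eq j[rule_format] by (simp add: baire_pair_def)
    also have "\<dots> \<longleftrightarrow> cantor_name y \<noteq> cantor_name x" by (simp only: fun_eq_iff not_all)
    finally show ?thesis by (simp only: inj_cantor_name)
  qed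
  obtain n where "cylinder x n \<subseteq> ce_open j q \<or> cylinder x n \<inter> ce_open j q = {}"
    using assms unfolding one_generic_in_def by blast
  then show False
  proof
    assume "cylinder x n \<subseteq> ce_open j q"
    then have "x \<in> ce_open j q" using mem_cylinder by (rule subsetD)
    then show False by (simp only: U)
  next
    define y where "y = x(n := \<not> x n)"
    assume "cylinder x n \<inter> ce_open j q = {}"
    moreover have "y \<in> cylinder x n" by (simp add: y_def cylinder_def)
    moreover have "y n \<noteq> x n" by (simp add: y_def)
    then have "y \<in> ce_open j q" unfolding U by (rule contrapos_nn) (rule fun_cong)
    ultimately show False by (simp add: disjoint_iff)
  qed
qed

text \<open>
  Effective Baire category: the search for a successful stage always terminates.
\<close>

lemma computable_solution:
  assumes P: "recursive (\<lambda>r. P)" and nd: "\<And>i. interior (neg_closed P i) = {}"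
  shows "\<exists>x. (\<forall>i. x \<notin> neg_closed P i) \<and> recursive (\<lambda>r. cantor_name x)"
proof -
  obtain x where x: "\<And>i. x \<notin> neg_closed P i"
    "\<And>t n. stage P t (Suc n) \<noteq> 0 \<Longrightarrow> approximation P t n = x n"
    using approximation_limit[OF nd] by blast
  have ex: "\<exists>t. stage P t (Suc n) \<noteq> 0" for n using stage_exists[OF nd, of "Suc n"] by (metis nat.distinct(1))
  have P': "recursive (\<lambda>r e. P (psnd e))" by (rule recursive_comp[OF P]) (intro recursive_intros)
  have "recursive (\<lambda>r n. LEAST t. stage P t (Suc n) \<noteq> 0)"
    by (rule recursive_Least) (intro recursive_intros P', rule ex)
  then have "decidable (\<lambda>r n. approximation P (LEAST t. stage P t (Suc n) \<noteq> 0) n)"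
    by (intro recursive_intros P')
  moreover have "approximation P (LEAST t. stage P t (Suc n) \<noteq> 0) n = x n" for n
    using x(2) LeastI_ex[OF ex] by blast
  ultimately have "decidable (\<lambda>r. x)" by simp
  then have "recursive (\<lambda>r. cantor_name x)" unfolding cantor_name_def decidable_def .
  with x(1) show ?thesis by blast
qed

lemma not_one_GEN_le_BCT0: "\<not> one_GEN \<le>\<^sub>W BCT0"
proof
  assume le: "one_GEN \<le>\<^sub>W BCT0"
  have "\<exists>q y. out_rep BCT0 q = Some y \<and> y \<in> vals BCT0 A" if "A \<in> pdom BCT0" for A
    using BCT_solvable that unfolding BCT0_simps(4) unfolding BCT0_def by blast
  from weihrauch_leE[OF le this] obtain k h where
    kh: "\<And>p x. in_rep one_GEN p = Some x \<Longrightarrow> x \<in> pdom one_GEN \<Longrightarrow>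
    \<exists>s x'. (\<forall>n. phi k p n = Some (s n)) \<and> in_rep BCT0 s = Some x' \<and> x' \<in> pdom BCT0 \<and>
      (\<forall>q y. out_rep BCT0 q = Some y \<and> y \<in> vals BCT0 x' \<longrightarrow>
        (\<exists>u z. (\<forall>n. phi h (baire_pair p q) n = Some (u n)) \<and> out_rep one_GEN u = Some z \<and> z \<in> vals one_GEN x))"
    by blast
  define q where "q = (\<lambda>_::nat. False)"
  have q: "recursive (\<lambda>r. cantor_name q)" unfolding q_def cantor_name_def by (intro recursive_intros)
  obtain s A where s: "\<And>n. phi k (cantor_name q) n = Some (s n)" "in_rep BCT0 s = Some A" "A \<in> pdom BCT0"
    and out: "\<And>u y. out_rep BCT0 u = Some y \<Longrightarrow> y \<in> vals BCT0 A \<Longrightarrow>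
        \<exists>v z. (\<forall>n. phi h (baire_pair (cantor_name q) u) n = Some (v n)) \<and> out_rep one_GEN v = Some z
          \<and> z \<in> vals one_GEN q"
    using kh[of "cantor_name q" q] by (auto simp: one_GEN_simps cantor_rep_eq_Some inj_cantor_name)
  have "recursive (\<lambda>r. s)" using recursive_phi[OF q] s(1) by blast
  then obtain x where x: "\<forall>i. x \<notin> A i" "recursive (\<lambda>r. cantor_name x)"
    using computable_solution[of s] s(2,3) unfolding BCT0_simps by blast
  then obtain v z where v: "\<And>n. phi h (baire_pair (cantor_name q) (cantor_name x)) n = Some (v n)"
    and z: "v = cantor_name z" "one_generic_in q z"
    using out[of "cantor_name x" x] by (auto simp: BCT0_simps one_GEN_simps cantor_rep_eq_Some)
  have "recursive (\<lambda>r. baire_pair (cantor_name q) (cantor_name x))"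
    unfolding baire_pair_def by (intro recursive_intros recursive_comp[OF q] recursive_comp[OF x(2)])
  then have "recursive (\<lambda>r. v)" using recursive_phi v by blast
  then show False using one_generic_not_computable[OF z(2)] z(1) by simp
qed

text \<open>
  The Baire category theorem, in the form that the points outside all \<open>A\<^sub>i\<close> are dense.
\<close>

lemma avoiding_point_in_cylinder:
  assumes "\<And>i. closed (A i)" "\<And>i. interior (A i) = {}"
  shows "\<exists>x\<in>cylinder y n. \<forall>i::nat. x \<notin> A i"
proof -
  let ?X = "product_topology (\<lambda>_. euclidean) UNIV :: cantor topology"
  have "compact_space (euclidean :: bool topology)"
    by (simp add: compact_space_def finite_imp_compact)
  then have "compact_space ?X" by (simp add: compact_space_product_topology)
  moreover have "Hausdorff_space (euclidean :: bool topology)"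
    unfolding Hausdorff_space_def
  proof (intro allI impI)
    fix a b :: bool assume "a \<in> topspace euclidean \<and> b \<in> topspace euclidean \<and> a \<noteq> b"
    then show "\<exists>U V. openin euclidean U \<and> openin euclidean V \<and> a \<in> U \<and> b \<in> V \<and> disjnt U V"
      by (intro exI[of _ "{a}"] exI[of _ "{b}"]) (simp add: open_discrete)
  qed
  then have "Hausdorff_space ?X" by (simp add: Hausdorff_space_product_topology)
  ultimately have "locally_compact_space ?X \<and> regular_space ?X"
    by (simp add: compact_imp_locally_compact_space locally_compact_Hausdorff_imp_regular_space)
  then have "?X interior_of \<Union>(range A) = {}"
    by (intro Baire_category_alt) (use assms in \<open>auto simp: euclidean_product_topology\<close>)
  then have "interior (\<Union>(range A)) = {}" by (simp add: euclidean_product_topology)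
  then show ?thesis unfolding interior_empty_iff by auto
qed

text \<open>
  The value \<open>q n\<close> is found by searching for a finite word and a certificate that the program outputs
  some \<open>v\<close> on oracles extending this word.  One of these oracles lies outside all \<open>A\<^sub>i\<close>, hence \<open>v = q n\<close>.
\<close>

lemma computed_by_comeager:
  assumes P: "recursive (\<lambda>r. p)"
    and A: "\<And>i. closed (A i)" "\<And>i. interior (A i) = {}"
    and h: "\<And>x n. \<forall>i::nat. x \<notin> A i \<Longrightarrow> phi h (baire_pair p (cantor_name x)) n = Some (q n)"
  shows "recursive (\<lambda>r. q)"
proof -
  define D where "D n e \<longleftrightarrow>
    certifies (baire_pair p (cantor_name (bit (pfst e)))) (pfst (psnd e)) h n (psnd (psnd e))" for n e
  have sound: "v = q n" if c: "certifies (baire_pair p (cantor_name (bit m))) s h n v" for m :: nat and s n v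
  proof -
    obtain x where x: "x \<in> cylinder (bit m) s" "\<forall>i. x \<notin> A i"
      using avoiding_point_in_cylinder[of A, OF A] by blast
    have "phi h (baire_pair p (cantor_name x)) n = Some v"
      using certifies_pair_snd_cylinder[OF c x(1)] phi_iff_certifies by blast
    then show ?thesis using h[OF x(2)] by simp
  qed
  have ex: "\<exists>e. D n e" for n
  proof -
    obtain x where x: "\<forall>i. x \<notin> A i" using avoiding_point_in_cylinder[of A, OF A] by blast
    obtain s where s: "certifies (baire_pair p (cantor_name x)) s h n (q n)"
      using h[OF x] phi_iff_certifies by blast
    obtain m :: nat where "\<forall>k<s. bit m k = x k" using ex_nat_with_bits by blast
    then have "certifies (baire_pair p (cantor_name (bit m))) s h n (q n)"
      by (intro certifies_pair_snd_cylinder[OF s]) (simp add: cylinder_def)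
    then show ?thesis unfolding D_def
      by (intro exI[of _ "prod_encode (m, prod_encode (s, q n))"]) simp
  qed
  have "recursive (\<lambda>r n. LEAST e. D n e)"
    by (rule recursive_Least) (unfold D_def, intro recursive_intros recursive_comp[OF P], rule ex[unfolded D_def])
  then have "recursive (\<lambda>r n. psnd (psnd (LEAST e. D n e)))" by (intro recursive_intros)
  moreover have "psnd (psnd (LEAST e. D n e)) = q n" for n
    using LeastI_ex[OF ex[of n]] sound unfolding D_def by blast
  ultimately show ?thesis by simp
qed

lemma not_lim_J_le_jump_BCT0: "\<not> lim_J \<le>\<^sub>W jump BCT0"
proof
  assume le: "lim_J \<le>\<^sub>W jump BCT0"
  have "pdom (jump BCT0) = pdom BCT0" "vals (jump BCT0) = vals BCT0"
    by (simp_all add: jump_def)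
  then have "\<exists>q y. out_rep (jump BCT0) q = Some y \<and> y \<in> vals (jump BCT0) A" if "A \<in> pdom (jump BCT0)" for A
    using BCT_solvable that unfolding jump_BCT0_simps(4) unfolding BCT0_def by auto
  from weihrauch_leE[OF le this] obtain k h where
    kh: "\<And>p x. in_rep lim_J p = Some x \<Longrightarrow> x \<in> pdom lim_J \<Longrightarrow>
    \<exists>s x'. (\<forall>n. phi k p n = Some (s n)) \<and> in_rep (jump BCT0) s = Some x' \<and> x' \<in> pdom (jump BCT0) \<and>
      (\<forall>q y. out_rep (jump BCT0) q = Some y \<and> y \<in> vals (jump BCT0) x' \<longrightarrow>
        (\<exists>u z. (\<forall>n. phi h (baire_pair p q) n = Some (u n)) \<and> out_rep lim_J u = Some z \<and> z \<in> vals lim_J x))"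
    by blast
  \<comment> \<open>All entries name the whole space, so that all sets of this instance are empty.\<close>
  define Q where "Q = (\<lambda>_::nat. Suc (prod_encode (0, 0)))"
  have "neg_closed Q i = {}" for i by (auto simp: neg_closed_def Q_def basic_ball_def cylinder_def)
  then obtain x where x: "one_generic_in (\<lambda>_. False) x"
    "lim_map (generic_approximations Q) = Some (cantor_name x)" "generic_approximations Q \<in> pdom lim_J"
    using generic_approximations_limit[of Q Q] by (auto simp: Q_def)
  define p where "p = generic_approximations Q"
  have p: "recursive (\<lambda>r. p)"
  proof -
    have "recursive (\<lambda>r. Q)" unfolding Q_def by (intro recursive_intros)
    then show ?thesis unfolding p_def using recursive_compose[OF recursive_generic_approximations] by blast
  qed
  obtain s A where A: "A \<in> pdom (jump BCT0)"
    and out: "\<And>u y. out_rep (jump BCT0) u = Some y \<Longrightarrow> y \<in> vals (jump BCT0) A \<Longrightarrow>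
        \<exists>v z. (\<forall>n. phi h (baire_pair p u) n = Some (v n)) \<and> out_rep lim_J v = Some z \<and> z \<in> vals lim_J p"
    using kh[of p p] x(3) by (auto simp: p_def lim_J_def baire_rep_def)
  have h: "phi h (baire_pair p (cantor_name y)) n = Some (cantor_name x n)" if "\<forall>i. y \<notin> A i" for y n
  proof -
    have "out_rep (jump BCT0) (cantor_name y) = Some y" "y \<in> vals (jump BCT0) A"
      using that by (simp_all add: jump_BCT0_simps cantor_rep_eq_Some)
    from out[OF this] obtain v z where "\<forall>n. phi h (baire_pair p (cantor_name y)) n = Some (v n)"
      "out_rep lim_J v = Some z" "z \<in> vals lim_J p" by blast
    then show ?thesis using x(2) by (simp add: lim_J_def baire_rep_def p_def)
  qed
  have "recursive (\<lambda>r. cantor_name x)"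
    using A h by (intro computed_by_comeager[OF p, of A h]) (simp_all add: jump_BCT0_simps)
  then show False using one_generic_not_computable[OF x(1)] by simp
qed

theorem corollary9p7:
  shows "BCT0 \<le>\<^sub>s\<^sub>W one_GEN \<and> one_GEN \<le>\<^sub>s\<^sub>W BCT2 \<and> BCT2 \<equiv>\<^sub>s\<^sub>W jump BCT0 \<and> jump BCT0 \<le>\<^sub>s\<^sub>W lim_J
    \<and> BCT0 <\<^sub>W one_GEN \<and> jump BCT0 <\<^sub>W lim_J"
  unfolding strong_weihrauch_equiv_def weihrauch_less_def
proof (intro conjI)
  show "BCT0 \<le>\<^sub>s\<^sub>W one_GEN" "BCT0 \<le>\<^sub>W one_GEN"
    by (rule reduces_by_strong_weihrauch_le reduces_by_weihrauch_le,
        rule recursive_graph_name, rule BCT0_reduces_one_GEN)+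
  show "one_GEN \<le>\<^sub>s\<^sub>W BCT2"
    by (rule reduces_by_strong_weihrauch_le,
        rule recursive_compose[OF recursive_kept_points recursive_frontier_sequence],
        rule reduces_by_trans[OF one_GEN_reduces_jump_BCT0 jump_BCT0_reduces_BCT2])
  show "BCT2 \<le>\<^sub>s\<^sub>W jump BCT0"
    by (rule reduces_by_strong_weihrauch_le, rule recursive_complement_sequence,
        rule BCT2_reduces_jump_BCT0)
  show "jump BCT0 \<le>\<^sub>s\<^sub>W BCT2"
    by (rule reduces_by_strong_weihrauch_le, rule recursive_kept_points, rule jump_BCT0_reduces_BCT2)
  show "jump BCT0 \<le>\<^sub>s\<^sub>W lim_J" "jump BCT0 \<le>\<^sub>W lim_J"
    by (rule reduces_by_strong_weihrauch_le reduces_by_weihrauch_le,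
        rule recursive_generic_approximations, rule jump_BCT0_reduces_lim_J)+
  show "\<not> one_GEN \<le>\<^sub>W BCT0" by (rule not_one_GEN_le_BCT0)
  show "\<not> lim_J \<le>\<^sub>W jump BCT0" by (rule not_lim_J_le_jump_BCT0)
qed

end
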